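(* Let $K$ be a field of arbitrary characteristic, and let $X=\{x_1,\ldots,x_n\}$, $n\ge 2$, and $Z=\{z_1,\ldots,z_m\}$ be disjoint finite sets of variables. Let $\varphi$ be an automorphism of $K[X,Z]$ or of $K\langle X,Z\rangle$ which fixes $Z$. If $\varphi$ is wild as a $Z$-automorphism, then it cannot be lifted to an automorphism of $K\{X,Z\}$ which also fixes $Z$.
   Context: $K[X,Z]$, $K\langle X,Z\rangle$ and $K\{X,Z\}$ are, respectively, the commutative polynomial algebra, the free associative algebra, and the absolutely free algebra (polynomials in noncommuting and nonassociative variables), all unital, freely generated by $X\cup Z$ over $K$. There are natural surjective homomorphisms $K\{X,Z\}\to K\langle X,Z\rangle\to K[X,Z]$ that are the identity on generators; an automorphism $\varphi$ of $K[X,Z]$ or $K\langle X,Z\rangle$ can be lifted to an automorphism $\Phi$ of $K\{X,Z\}$ if $\Phi$ induces $\varphi$ via the natural homomorphism. In each of these algebras, a $Z$-automorphism is an automorphism fixing every $z_1,\ldots,z_m$. It is $Z$-elementary if it is of the form $(x_1,\ldots,x_{j-1},\alpha x_j+f(X,Z),x_{j+1},\ldots,x_n,z_1,\ldots,z_m)$ (the tuple of images of the generators) with $\alpha\in K^{\ast}$ and $f(X,Z)$ not depending on $x_j$. A $Z$-automorphism is tame as a $Z$-automorphism if it belongs to the group generated by the $Z$-elementary automorphisms; otherwise it is wild as a $Z$-automorphism. *)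

theory Defs
  imports "HOL-Library.Poly_Mapping" "HOL-Algebra.Bij" "HOL-Algebra.Generated_Groups"
begin

section \<open>Algebras spanned by monomials\<close>

text \<open>
  An algebra with basis \<open>'b\<close> is the type of finitely supported functions \<open>'b \<Rightarrow>\<^sub>0 'k\<close>; monomials are
  multiplied by \<open>+\<close>, and \<open>0\<close> is the empty monomial. The library's \<open>*\<close> on this type requires
  \<open>'b\<close> to be a monoid, so it is not available for nonassociative monomials. The product below
  makes sense for all three algebras and is the library's product where the latter exists
  (lemma \<open>mon_mult_eq_times\<close>).
\<close>

definition mon_mult :: "('b::plus \<Rightarrow>\<^sub>0 'k::semiring_0) \<Rightarrow> ('b \<Rightarrow>\<^sub>0 'k) \<Rightarrow> ('b \<Rightarrow>\<^sub>0 'k)"  (infixl \<open>\<star>\<close> 70)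
  where "p \<star> q = (\<Sum>a\<in>Poly_Mapping.keys p. \<Sum>b\<in>Poly_Mapping.keys q.
           Poly_Mapping.single (a + b) (Poly_Mapping.lookup p a * Poly_Mapping.lookup q b))"

definition mon_smult :: "'k::semiring_0 \<Rightarrow> ('b \<Rightarrow>\<^sub>0 'k) \<Rightarrow> ('b \<Rightarrow>\<^sub>0 'k)"
  where "mon_smult c p = Poly_Mapping.map ((*) c) p"

text \<open>The linear extension of a map between monomials:\<close>

definition mon_map :: "('a \<Rightarrow> 'b) \<Rightarrow> ('a \<Rightarrow>\<^sub>0 'k::comm_monoid_add) \<Rightarrow> ('b \<Rightarrow>\<^sub>0 'k)"
  where "mon_map h p = (\<Sum>a\<in>Poly_Mapping.keys p. Poly_Mapping.single (h a) (Poly_Mapping.lookup p a))"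

definition algebra_hom :: "(('a::{plus,zero} \<Rightarrow>\<^sub>0 'k::field) \<Rightarrow> ('b::{plus,zero} \<Rightarrow>\<^sub>0 'k)) \<Rightarrow> bool"
  where "algebra_hom \<phi> \<longleftrightarrow>
    \<phi> 1 = 1 \<and>
    (\<forall>p q. \<phi> (p + q) = \<phi> p + \<phi> q) \<and>
    (\<forall>c p. \<phi> (mon_smult c p) = mon_smult c (\<phi> p)) \<and>
    (\<forall>p q. \<phi> (p \<star> q) = \<phi> p \<star> \<phi> q)"

definition algebra_automorphism :: "(('b::{plus,zero} \<Rightarrow>\<^sub>0 'k::field) \<Rightarrow> ('b \<Rightarrow>\<^sub>0 'k)) \<Rightarrow> bool"
  where "algebra_automorphism \<phi> \<longleftrightarrow> algebra_hom \<phi> \<and> bij \<phi>"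


section \<open>Tame and wild automorphisms\<close>

text \<open>
  \<open>gen v\<close> is the variable \<open>v\<close> as a monomial, and \<open>occ a\<close> is the set of variables
  occurring in the monomial \<open>a\<close>.
\<close>

locale polynomial_algebra =
  fixes gen :: "'v \<Rightarrow> 'b::{plus,zero}"
    and occ :: "'b \<Rightarrow> 'v set"
begin

definition var :: "'v \<Rightarrow> ('b \<Rightarrow>\<^sub>0 'k::field)"
  where "var v = Poly_Mapping.single (gen v) 1"

definition depends_on :: "('b \<Rightarrow>\<^sub>0 'k::field) \<Rightarrow> 'v \<Rightarrow> bool"
  where "depends_on f v \<longleftrightarrow> (\<exists>a\<in>Poly_Mapping.keys f. v \<in> occ a)"

definition Z_automorphism :: "'v set \<Rightarrow> (('b \<Rightarrow>\<^sub>0 'k::field) \<Rightarrow> ('b \<Rightarrow>\<^sub>0 'k)) \<Rightarrow> bool"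
  where "Z_automorphism Z \<phi> \<longleftrightarrow> algebra_automorphism \<phi> \<and> (\<forall>z\<in>Z. \<phi> (var z) = var z)"

definition Z_elementary :: "'v set \<Rightarrow> 'v set \<Rightarrow> (('b \<Rightarrow>\<^sub>0 'k::field) \<Rightarrow> ('b \<Rightarrow>\<^sub>0 'k)) \<Rightarrow> bool"
  where "Z_elementary X Z \<phi> \<longleftrightarrow> Z_automorphism Z \<phi> \<and>
    (\<exists>j\<in>X. \<exists>\<alpha> f. \<alpha> \<noteq> 0 \<and> \<not> depends_on f j \<and>
       \<phi> (var j) = mon_smult \<alpha> (var j) + f \<and>
       (\<forall>x\<in>X - {j}. \<phi> (var x) = var x))"

definition Z_tame :: "'v set \<Rightarrow> 'v set \<Rightarrow> (('b \<Rightarrow>\<^sub>0 'k::field) \<Rightarrow> ('b \<Rightarrow>\<^sub>0 'k)) \<Rightarrow> bool"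
  where "Z_tame X Z \<phi> \<longleftrightarrow> \<phi> \<in> generate (BijGroup UNIV) {\<psi>. Z_elementary X Z \<psi>}"

definition Z_wild :: "'v set \<Rightarrow> 'v set \<Rightarrow> (('b \<Rightarrow>\<^sub>0 'k::field) \<Rightarrow> ('b \<Rightarrow>\<^sub>0 'k)) \<Rightarrow> bool"
  where "Z_wild X Z \<phi> \<longleftrightarrow> Z_automorphism Z \<phi> \<and> \<not> Z_tame X Z \<phi>"

end


section \<open>The three kinds of monomials\<close>

text \<open>Noncommuting monomials; the wrapper around lists only serves to carry the monoid structure.\<close>

datatype 'v word = Word (letters: "'v list")

instantiation word :: (type) monoid_add
begin

definition zero_word :: "'a word"
  where "0 = Word []"

definition plus_word :: "'a word \<Rightarrow> 'a word \<Rightarrow> 'a word"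
  where "u + w = Word (letters u @ letters w)"

instance
  by standard (simp_all add: zero_word_def plus_word_def)

end

text \<open>Nonassociative monomials: bracketed nonempty words together with an adjoined unit.\<close>

datatype 'v bracketing = Leaf 'v | Node "'v bracketing" "'v bracketing"

datatype 'v na_monomial = Empty | Bracketed "'v bracketing"

instantiation na_monomial :: (type) "{plus,zero}"
begin

definition zero_na_monomial :: "'a na_monomial"
  where "0 = Empty"

fun plus_na_monomial :: "'a na_monomial \<Rightarrow> 'a na_monomial \<Rightarrow> 'a na_monomial"
  where
    "Empty + u = u"
  | "Bracketed s + Empty = Bracketed s"
  | "Bracketed s + Bracketed t = Bracketed (Node s t)"

instance ..

end

primrec leaves :: "'v bracketing \<Rightarrow> 'v list"
  where
    "leaves (Leaf v) = [v]"
  | "leaves (Node s t) = leaves s @ leaves t"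

primrec unbracket :: "'v na_monomial \<Rightarrow> 'v word"
  where
    "unbracket Empty = Word []"
  | "unbracket (Bracketed t) = Word (leaves t)"

text \<open>A commuting monomial is the function giving the exponent of each variable.\<close>

definition single_var :: "'v \<Rightarrow> ('v \<Rightarrow>\<^sub>0 nat)"
  where "single_var v = Poly_Mapping.single v 1"

definition abelianize :: "'v word \<Rightarrow> ('v \<Rightarrow>\<^sub>0 nat)"
  where "abelianize w = (\<Sum>v\<leftarrow>letters w. single_var v)"

type_synonym ('v, 'k) comm_poly = "('v \<Rightarrow>\<^sub>0 nat) \<Rightarrow>\<^sub>0 'k"
type_synonym ('v, 'k) assoc_poly = "'v word \<Rightarrow>\<^sub>0 'k"
type_synonym ('v, 'k) nonassoc_poly = "'v na_monomial \<Rightarrow>\<^sub>0 'k"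

interpretation comm: polynomial_algebra single_var Poly_Mapping.keys .

interpretation assoc: polynomial_algebra "\<lambda>v. Word [v]" "\<lambda>w. set (letters w)" .

interpretation nonassoc: polynomial_algebra "\<lambda>v. Bracketed (Leaf v)" "\<lambda>u. set (letters (unbracket u))" .


section \<open>Natural homomorphisms and liftings\<close>

definition nonassoc_to_assoc :: "('v, 'k::field) nonassoc_poly \<Rightarrow> ('v, 'k) assoc_poly"
  where "nonassoc_to_assoc = mon_map unbracket"

definition assoc_to_comm :: "('v, 'k::field) assoc_poly \<Rightarrow> ('v, 'k) comm_poly"
  where "assoc_to_comm = mon_map abelianize"

definition nonassoc_to_comm :: "('v, 'k::field) nonassoc_poly \<Rightarrow> ('v, 'k) comm_poly"
  where "nonassoc_to_comm = assoc_to_comm \<circ> nonassoc_to_assoc"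

definition induces_via :: "('a \<Rightarrow> 'b) \<Rightarrow> ('a \<Rightarrow> 'a) \<Rightarrow> ('b \<Rightarrow> 'b) \<Rightarrow> bool"
  where "induces_via \<pi> \<Phi> \<phi> \<longleftrightarrow> (\<forall>p. \<pi> (\<Phi> p) = \<phi> (\<pi> p))"


section \<open>Checks on the definitions\<close>

lemma mon_map_superset:
  assumes "finite A" "Poly_Mapping.keys p \<subseteq> A"
  shows "mon_map h p = (\<Sum>a\<in>A. Poly_Mapping.single (h a) (Poly_Mapping.lookup p a))"
  unfolding mon_map_def
  by (rule sum.mono_neutral_left) (use assms in \<open>auto simp: in_keys_iff\<close>)

lemma mon_map_single [simp]: "mon_map h (Poly_Mapping.single a c) = Poly_Mapping.single (h a) c"
  by (subst mon_map_superset[of "{a}"]) auto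

lemma mon_map_zero [simp]: "mon_map h 0 = 0"
  by (simp add: mon_map_def)

lemma mon_map_add: "mon_map h (p + q) = mon_map h p + mon_map h q"
proof -
  let ?A = "Poly_Mapping.keys p \<union> Poly_Mapping.keys q"
  have "Poly_Mapping.keys (p + q) \<subseteq> ?A"
    by (rule Poly_Mapping.keys_add)
  then show ?thesis
    by (simp add: mon_map_superset[of ?A] lookup_add single_add sum.distrib)
qed

lemma mon_map_sum: "mon_map h (sum f A) = (\<Sum>a\<in>A. mon_map h (f a))"
  by (induction A rule: infinite_finite_induct) (simp_all add: mon_map_add)

lemma lookup_mon_smult [simp]:
  "Poly_Mapping.lookup (mon_smult c p) b = c * Poly_Mapping.lookup p b"
  by (simp add: mon_smult_def map.rep_eq when_def)

lemma mon_map_smult: "mon_map h (mon_smult c p) = mon_smult c (mon_map h p)"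
proof (rule poly_mapping_eqI)
  fix b
  have "Poly_Mapping.keys (mon_smult c p) \<subseteq> Poly_Mapping.keys p"
    by (auto simp: in_keys_iff)
  then have "mon_map h (mon_smult c p) =
    (\<Sum>a\<in>Poly_Mapping.keys p. Poly_Mapping.single (h a) (c * Poly_Mapping.lookup p a))"
    by (simp add: mon_map_superset[of "Poly_Mapping.keys p"])
  then show "Poly_Mapping.lookup (mon_map h (mon_smult c p)) b =
      Poly_Mapping.lookup (mon_smult c (mon_map h p)) b"
    by (simp add: mon_map_def[of h p] lookup_sum sum_distrib_left lookup_single mult_when)
qed

lemma mon_mult_superset:
  assumes "finite A" "Poly_Mapping.keys p \<subseteq> A" "finite B" "Poly_Mapping.keys q \<subseteq> B"
  shows "p \<star> q = (\<Sum>a\<in>A. \<Sum>b\<in>B.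
           Poly_Mapping.single (a + b) (Poly_Mapping.lookup p a * Poly_Mapping.lookup q b))"
proof -
  have "p \<star> q = (\<Sum>a\<in>Poly_Mapping.keys p. \<Sum>b\<in>B.
           Poly_Mapping.single (a + b) (Poly_Mapping.lookup p a * Poly_Mapping.lookup q b))"
    unfolding mon_mult_def
    by (intro sum.cong refl sum.mono_neutral_left) (use assms in \<open>auto simp: in_keys_iff\<close>)
  also have "\<dots> = (\<Sum>a\<in>A. \<Sum>b\<in>B.
           Poly_Mapping.single (a + b) (Poly_Mapping.lookup p a * Poly_Mapping.lookup q b))"
    by (rule sum.mono_neutral_left) (use assms in \<open>auto simp: in_keys_iff\<close>)
  finally show ?thesis .
qed

lemma mon_mult_single [simp]:
  "Poly_Mapping.single a c \<star> Poly_Mapping.single b d = Poly_Mapping.single (a + b) (c * d)"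
  by (subst mon_mult_superset[of "{a}" _ "{b}"]) auto

lemma mon_mult_zero [simp]: "0 \<star> p = 0" "p \<star> 0 = 0"
  by (simp_all add: mon_mult_def)

lemma mon_mult_add_left: "(p + q) \<star> r = p \<star> r + q \<star> r"
proof -
  let ?A = "Poly_Mapping.keys p \<union> Poly_Mapping.keys q"
  have "Poly_Mapping.keys (p + q) \<subseteq> ?A"
    by (rule Poly_Mapping.keys_add)
  then show ?thesis
    by (simp add: mon_mult_superset[of ?A _ "Poly_Mapping.keys r"] lookup_add single_add
        distrib_right sum.distrib)
qed

lemma mon_mult_add_right: "r \<star> (p + q) = r \<star> p + r \<star> q"
proof -
  let ?A = "Poly_Mapping.keys p \<union> Poly_Mapping.keys q"
  have "Poly_Mapping.keys (p + q) \<subseteq> ?A"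
    by (rule Poly_Mapping.keys_add)
  then show ?thesis
    by (simp add: mon_mult_superset[of "Poly_Mapping.keys r" _ ?A] lookup_add single_add
        distrib_left sum.distrib)
qed

lemma mon_mult_sum_left: "sum f A \<star> r = (\<Sum>a\<in>A. f a \<star> r)"
  by (induction A rule: infinite_finite_induct) (simp_all add: mon_mult_add_left)

lemma mon_mult_sum_right: "r \<star> sum f A = (\<Sum>a\<in>A. r \<star> f a)"
  by (induction A rule: infinite_finite_induct) (simp_all add: mon_mult_add_right)

lemma sum_single_keys:
  "(\<Sum>a\<in>Poly_Mapping.keys p. Poly_Mapping.single a (Poly_Mapping.lookup p a)) = p"
  by (rule poly_mapping_eqI) (auto simp: lookup_sum lookup_single when_def in_keys_iff)

theorem mon_mult_eq_times:
  fixes p q :: "'b::monoid_add \<Rightarrow>\<^sub>0 'k::semiring_0"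
  shows "p \<star> q = p * q"
proof -
  have "p * q = (\<Sum>a\<in>Poly_Mapping.keys p. Poly_Mapping.single a (Poly_Mapping.lookup p a)) *
                (\<Sum>b\<in>Poly_Mapping.keys q. Poly_Mapping.single b (Poly_Mapping.lookup q b))"
    by (simp only: sum_single_keys)
  also have "\<dots> = p \<star> q"
    by (simp add: sum_product mult_single mon_mult_def)
  finally show ?thesis by simp
qed

lemma mon_map_mult:
  assumes "\<And>a b. h (a + b) = h a + h b"
  shows "mon_map h (p \<star> q) = mon_map h p \<star> mon_map h q"
proof -
  have "mon_map h (p \<star> q) = (\<Sum>a\<in>Poly_Mapping.keys p. \<Sum>b\<in>Poly_Mapping.keys q.
    Poly_Mapping.single (h a + h b) (Poly_Mapping.lookup p a * Poly_Mapping.lookup q b))"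
    by (simp add: mon_mult_def mon_map_sum assms)
  also have "\<dots> = mon_map h p \<star> mon_map h q"
    unfolding mon_map_def[of h p] mon_map_def[of h q] mon_mult_sum_left
    unfolding mon_mult_sum_right mon_mult_single ..
  finally show ?thesis .
qed

lemma algebra_hom_mon_map:
  assumes "h 0 = 0" "\<And>a b. h (a + b) = h a + h b"
  shows "algebra_hom (mon_map h)"
  unfolding algebra_hom_def
  using assms by (auto simp: mon_map_add mon_map_smult mon_map_mult simp flip: single_one)

lemma surj_mon_map:
  assumes "surj h"
  shows "surj (mon_map h)"
proof (rule surjI)
  fix p
  show "mon_map h (mon_map (inv_into UNIV h) p) = p"
    using assms by (simp add: mon_map_def[of "inv_into UNIV h" p] mon_map_sum surj_f_inv_f sum_single_keys)
qed

lemma unbracket_add: "unbracket (a + b) = unbracket a + unbracket b"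
  by (cases a; cases b) (simp_all add: plus_word_def)

lemma surj_unbracket: "surj unbracket"
proof -
  have "\<exists>u. unbracket u = Word xs" for xs :: "'a list"
  proof (induction xs)
    case Nil
    show ?case by (rule exI[of _ Empty]) simp
  next
    case (Cons x xs)
    then obtain u where u: "unbracket u = Word xs" by blast
    show ?case
      by (rule exI[of _ "Bracketed (Leaf x) + u"]) (simp add: unbracket_add u plus_word_def)
  qed
  then show ?thesis
    by (metis surj_def word.exhaust)
qed

lemma abelianize_add: "abelianize (a + b) = abelianize a + abelianize b"
  by (simp add: abelianize_def plus_word_def)

lemma surj_abelianize: "surj abelianize"
proof -
  have single: "\<exists>w. abelianize w = Poly_Mapping.single v n" for v :: 'a and n
    by (rule exI[of _ "Word (replicate n v)"], induction n)
      (auto simp: abelianize_def single_var_def simp flip: single_add)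
  have "\<exists>w. abelianize w = (\<Sum>v\<in>A. Poly_Mapping.single v (g v))" if "finite A" for A :: "'a set" and g
    using that
  proof induction
    case empty
    show ?case by (rule exI[of _ "Word []"]) (simp add: abelianize_def)
  next
    case (insert v A)
    from insert.IH obtain w where w: "abelianize w = (\<Sum>v\<in>A. Poly_Mapping.single v (g v))" ..
    from single obtain w' where w': "abelianize w' = Poly_Mapping.single v (g v)" by blast
    show ?case
      by (rule exI[of _ "w' + w"]) (use insert.hyps in \<open>simp add: abelianize_add w w'\<close>)
  qed
  then have "\<exists>w. abelianize w = p" for p :: "'a \<Rightarrow>\<^sub>0 nat"
    using sum_single_keys[of p] finite_keys[of p] by metis
  then show ?thesis
    unfolding surj_def by metis
qed

theorem nonassoc_to_assoc_natural:
  "algebra_hom nonassoc_to_assoc" "surj nonassoc_to_assoc"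
  "nonassoc_to_assoc (nonassoc.var v) = assoc.var v"
proof -
  show "algebra_hom nonassoc_to_assoc"
    unfolding nonassoc_to_assoc_def
    by (rule algebra_hom_mon_map)
      (simp_all add: unbracket_add zero_na_monomial_def zero_word_def)
  show "surj nonassoc_to_assoc"
    unfolding nonassoc_to_assoc_def by (rule surj_mon_map[OF surj_unbracket])
  show "nonassoc_to_assoc (nonassoc.var v) = assoc.var v"
    by (simp add: nonassoc_to_assoc_def nonassoc.var_def assoc.var_def)
qed

theorem assoc_to_comm_natural:
  "algebra_hom assoc_to_comm" "surj assoc_to_comm"
  "assoc_to_comm (assoc.var v) = comm.var v"
proof -
  show "algebra_hom assoc_to_comm"
    unfolding assoc_to_comm_def
    by (rule algebra_hom_mon_map) (simp_all add: abelianize_add, simp add: abelianize_def zero_word_def)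
  show "surj assoc_to_comm"
    unfolding assoc_to_comm_def by (rule surj_mon_map[OF surj_abelianize])
  show "assoc_to_comm (assoc.var v) = comm.var v"
    by (simp add: assoc_to_comm_def assoc.var_def comm.var_def abelianize_def)
qed

end

theory Submission
  imports Defs
begin

text \<open>
  The theorem holds because the absolutely free algebra has no wild automorphisms: every
  \<open>Z\<close>-automorphism of \<open>K{X,Z}\<close> is tame as a \<open>Z\<close>-automorphism (lemma
  \<open>nonassoc_automorphism_tame\<close>). If \<open>\<Phi>\<close> lifts \<open>\<phi>\<close>, write \<open>\<Phi>\<close> as a product of
  \<open>Z\<close>-elementary automorphisms and their inverses. Each factor induces, along the natural
  homomorphism, a \<open>Z\<close>-elementary automorphism downstairs or the inverse of one, and the product
  of these is \<open>\<phi>\<close>; so \<open>\<phi>\<close> is tame (lemma \<open>tame_descends\<close>).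

  Tameness upstairs is the classical degree reduction for free nonassociative algebras. Let
  \<open>f v = \<Phi> v\<close> have degree \<open>d v\<close>, and give each variable \<open>v\<close> the weight \<open>d v\<close>. If for some
  \<open>x \<in> X\<close> the leading form of \<open>f x\<close> can be cancelled by a polynomial \<open>G\<close> in the other \<open>f v\<close>, then
  composing \<open>\<Phi>\<close> with the elementary automorphism \<open>x \<mapsto> x + G\<close> lowers the sum of the degrees.
  Otherwise the leading forms of the \<open>f v\<close> satisfy no relation at all: for every polynomial \<open>P\<close> the
  degree of \<open>P(f)\<close> is the weighted degree of \<open>P\<close> (lemma \<open>irreducible_independent\<close>).
  Applied to \<open>P = \<Phi>\<inverse> x\<close>, for which \<open>P(f) = x\<close> has degree one, this shows that \<open>\<Phi>\<inverse>\<close> is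
  affine, and an affine automorphism is tame by Gaussian elimination
  (lemma \<open>affine_automorphism_tame\<close>).

  The independence of the leading forms is where nonassociativity enters: the polynomials spanned by
  products of two nonconstant monomials form the tensor square of the augmentation ideal. If
  \<open>P = L + \<Sum> A\<^sub>t t\<close>, with \<open>L\<close> linear and \<open>t\<close> ranging over
  distinct monomials, is homogeneous and yields a relation, then \<open>L\<close> must vanish, since otherwise it
  would provide a reduction. Comparing coefficients at the left factors of products
  then turns \<open>\<Sum> A\<^sub>t(f) t(f) = 0\<close> into relations of smaller weight, first among the
  right factors \<open>t\<close> and then for each \<open>A\<^sub>t\<close>.
\<close>

section \<open>Linear extensions and algebra homomorphisms\<close>

lemma mon_smult_single [simp]:
  "mon_smult c (Poly_Mapping.single a d) = Poly_Mapping.single a (c * d)"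
  by (rule poly_mapping_eqI) (simp add: lookup_single mult_when)

lemma mon_smult_add_right: "mon_smult c (p + q) = mon_smult c p + mon_smult c q"
  by (rule poly_mapping_eqI) (simp add: lookup_add algebra_simps)

lemma mon_smult_add_left: "mon_smult (c + d) p = mon_smult c p + mon_smult d p"
  by (rule poly_mapping_eqI) (simp add: lookup_add algebra_simps)

lemma mon_smult_smult: "mon_smult c (mon_smult d p) = mon_smult (c * d) p"
  for c d :: "'k::field"
  by (rule poly_mapping_eqI) (simp add: algebra_simps)

lemma mon_smult_zero [simp]: "mon_smult c 0 = 0" "mon_smult 0 p = 0"
  by (auto intro!: poly_mapping_eqI)

lemma mon_smult_one [simp]: "mon_smult (1::'k::field) p = p"
  by (auto intro!: poly_mapping_eqI)

lemma mon_smult_minus_one: "mon_smult (-1::'k::field) p = - p"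
  by (auto intro!: poly_mapping_eqI)

lemma mon_smult_sum: "mon_smult c (sum f A) = (\<Sum>a\<in>A. mon_smult c (f a))"
  by (induction A rule: infinite_finite_induct) (simp_all add: mon_smult_add_right)

lemma keys_mon_smult: "Poly_Mapping.keys (mon_smult c p) \<subseteq> Poly_Mapping.keys p"
  by (auto simp: in_keys_iff)

lemma lookup_mon_mult:
  "Poly_Mapping.lookup (p \<star> q) s = (\<Sum>a\<in>Poly_Mapping.keys p. \<Sum>b\<in>Poly_Mapping.keys q.
     (Poly_Mapping.lookup p a * Poly_Mapping.lookup q b when a + b = s))"
  by (simp add: mon_mult_def lookup_sum lookup_single)

lemma keys_mon_mult:
  "Poly_Mapping.keys (p \<star> q) \<subseteq> {a + b | a b. a \<in> Poly_Mapping.keys p \<and> b \<in> Poly_Mapping.keys q}"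
proof
  fix s assume "s \<in> Poly_Mapping.keys (p \<star> q)"
  then have "(\<Sum>a\<in>Poly_Mapping.keys p. \<Sum>b\<in>Poly_Mapping.keys q.
     (Poly_Mapping.lookup p a * Poly_Mapping.lookup q b when a + b = s)) \<noteq> 0"
    by (simp add: in_keys_iff flip: lookup_mon_mult)
  then obtain a b where "a \<in> Poly_Mapping.keys p" "b \<in> Poly_Mapping.keys q" "a + b = s"
    by (elim sum.not_neutral_contains_not_neutral) (auto simp: when_def split: if_splits)
  then show "s \<in> {a + b | a b. a \<in> Poly_Mapping.keys p \<and> b \<in> Poly_Mapping.keys q}"
    by blast
qed

lemma mon_mult_smult_left: "mon_smult c p \<star> q = mon_smult c (p \<star> q)"
  for c :: "'k::field"
proof -
  have "mon_smult c p \<star> q = (\<Sum>a\<in>Poly_Mapping.keys p. \<Sum>b\<in>Poly_Mapping.keys q.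
    Poly_Mapping.single (a + b) (Poly_Mapping.lookup (mon_smult c p) a * Poly_Mapping.lookup q b))"
    by (rule mon_mult_superset) (auto simp: in_keys_iff)
  then show ?thesis
    by (simp add: mon_mult_def[of p q] mon_smult_sum mult.assoc)
qed

lemma mon_mult_smult_right: "p \<star> mon_smult c q = mon_smult c (p \<star> q)"
  for c :: "'k::field"
proof -
  have "p \<star> mon_smult c q = (\<Sum>a\<in>Poly_Mapping.keys p. \<Sum>b\<in>Poly_Mapping.keys q.
    Poly_Mapping.single (a + b) (Poly_Mapping.lookup p a * Poly_Mapping.lookup (mon_smult c q) b))"
    by (rule mon_mult_superset) (auto simp: in_keys_iff)
  then show ?thesis
    by (simp add: mon_mult_def[of p q] mon_smult_sum mult.left_commute)
qed

definition linear_extension :: "('a \<Rightarrow> ('b \<Rightarrow>\<^sub>0 'k::field)) \<Rightarrow> ('a \<Rightarrow>\<^sub>0 'k) \<Rightarrow> ('b \<Rightarrow>\<^sub>0 'k)"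
  where "linear_extension m p =
    (\<Sum>a\<in>Poly_Mapping.keys p. mon_smult (Poly_Mapping.lookup p a) (m a))"

lemma linear_extension_superset:
  assumes "finite A" "Poly_Mapping.keys p \<subseteq> A"
  shows "linear_extension m p = (\<Sum>a\<in>A. mon_smult (Poly_Mapping.lookup p a) (m a))"
  unfolding linear_extension_def
  by (rule sum.mono_neutral_left) (use assms in \<open>auto simp: in_keys_iff\<close>)

lemma linear_extension_single [simp]:
  "linear_extension m (Poly_Mapping.single a c) = mon_smult c (m a)"
  by (subst linear_extension_superset[of "{a}"]) auto

lemma linear_extension_zero [simp]: "linear_extension m 0 = 0"
  by (simp add: linear_extension_def)

lemma linear_extension_add:
  "linear_extension m (p + q) = linear_extension m p + linear_extension m q"
proof -
  let ?A = "Poly_Mapping.keys p \<union> Poly_Mapping.keys q"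
  have "Poly_Mapping.keys (p + q) \<subseteq> ?A"
    by (rule Poly_Mapping.keys_add)
  then show ?thesis
    by (simp add: linear_extension_superset[of ?A] lookup_add mon_smult_add_left sum.distrib)
qed

lemma linear_extension_smult:
  "linear_extension m (mon_smult c p) = mon_smult c (linear_extension m p)"
  by (subst linear_extension_superset[OF finite_keys keys_mon_smult])
    (simp add: linear_extension_def[of m p] mon_smult_sum mon_smult_smult)

lemma linear_extension_sum:
  "linear_extension m (sum f A) = (\<Sum>a\<in>A. linear_extension m (f a))"
  by (induction A rule: infinite_finite_induct) (simp_all add: linear_extension_add)

lemma algebra_hom_linear_extension:
  assumes "m 0 = 1" "\<And>a b. m (a + b) = m a \<star> m b"
  shows "algebra_hom (linear_extension m)"
proof -
  have "linear_extension m (p \<star> q) = linear_extension m p \<star> linear_extension m q" for p q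
  proof -
    have "linear_extension m (p \<star> q) = (\<Sum>a\<in>Poly_Mapping.keys p. \<Sum>b\<in>Poly_Mapping.keys q.
        mon_smult (Poly_Mapping.lookup p a * Poly_Mapping.lookup q b) (m a \<star> m b))"
      by (simp add: mon_mult_def[of p q] linear_extension_sum assms(2))
    also have "\<dots> = linear_extension m p \<star> linear_extension m q"
      unfolding linear_extension_def[of m p] linear_extension_def[of m q] mon_mult_sum_left
      by (simp add: mon_mult_sum_right mon_mult_smult_left mon_mult_smult_right mon_smult_smult
          mult.commute mon_smult_sum)
    finally show ?thesis .
  qed
  moreover have "linear_extension m 1 = 1"
    using assms(1) by (simp flip: single_one)
  ultimately show ?thesis
    by (simp add: algebra_hom_def linear_extension_add linear_extension_smult)
qed

lemma algebra_hom_zero: "algebra_hom \<phi> \<Longrightarrow> \<phi> 0 = 0"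
  using mon_smult_zero(2)[of 0] unfolding algebra_hom_def by (metis mon_smult_zero(2))

lemma algebra_hom_sum: "algebra_hom \<phi> \<Longrightarrow> \<phi> (sum f A) = (\<Sum>a\<in>A. \<phi> (f a))"
  by (induction A rule: infinite_finite_induct)
    (simp_all add: algebra_hom_zero, simp add: algebra_hom_def)

lemma algebra_hom_diff:
  assumes "algebra_hom \<phi>"
  shows "\<phi> (p - q) = \<phi> p - \<phi> q"
proof -
  have "\<phi> (p - q) + \<phi> q = \<phi> p"
    using assms unfolding algebra_hom_def by (metis diff_add_cancel)
  then show ?thesis by (simp add: eq_diff_eq)
qed

lemma algebra_hom_eq_linear_extension:
  assumes "algebra_hom \<phi>"
  shows "\<phi> = linear_extension (\<lambda>a. \<phi> (Poly_Mapping.single a 1))"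
proof
  fix p
  have "\<phi> p = \<phi> (\<Sum>a\<in>Poly_Mapping.keys p.
      mon_smult (Poly_Mapping.lookup p a) (Poly_Mapping.single a 1))"
    by (simp add: sum_single_keys)
  also have "\<dots> = linear_extension (\<lambda>a. \<phi> (Poly_Mapping.single a 1)) p"
    using assms by (simp only: algebra_hom_sum[OF assms] linear_extension_def)
      (simp add: algebra_hom_def del: mon_smult_single)
  finally show "\<phi> p = linear_extension (\<lambda>a. \<phi> (Poly_Mapping.single a 1)) p" .
qed

lemma algebra_hom_comp: "algebra_hom \<phi> \<Longrightarrow> algebra_hom \<psi> \<Longrightarrow> algebra_hom (\<phi> \<circ> \<psi>)"
  by (simp add: algebra_hom_def)

lemma algebra_hom_id: "algebra_hom id"
  by (simp add: algebra_hom_def)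

lemma algebra_hom_inv:
  assumes "algebra_hom \<phi>" "bij \<phi>"
  shows "algebra_hom (inv_into UNIV \<phi>)"
proof -
  have 1: "\<phi> (inv_into UNIV \<phi> p) = p" for p
    using assms(2) by (simp add: bij_is_surj surj_f_inv_f)
  have 2: "inv_into UNIV \<phi> q = p" if "\<phi> p = q" for p q
    using assms(2) that by (auto simp: bij_is_inj inv_f_f)
  have hom: "\<phi> 1 = 1" "\<And>p q. \<phi> (p + q) = \<phi> p + \<phi> q"
    "\<And>c p. \<phi> (mon_smult c p) = mon_smult c (\<phi> p)" "\<And>p q. \<phi> (p \<star> q) = \<phi> p \<star> \<phi> q"
    using assms(1) by (simp_all add: algebra_hom_def)
  show ?thesis
    unfolding algebra_hom_def by (intro conjI allI; rule 2; simp only: hom 1)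
qed

section \<open>The tame group\<close>

context polynomial_algebra
begin

lemma Z_automorphism_comp:
  "Z_automorphism Z \<phi> \<Longrightarrow> Z_automorphism Z \<psi> \<Longrightarrow> Z_automorphism Z (\<phi> \<circ> \<psi>)"
  unfolding Z_automorphism_def algebra_automorphism_def
  by (auto intro: algebra_hom_comp bij_comp)

lemma Z_automorphism_inv:
  assumes "Z_automorphism Z \<phi>"
  shows "Z_automorphism Z (inv_into UNIV \<phi>)"
proof -
  have \<phi>: "algebra_hom \<phi>" "bij \<phi>" "\<And>z. z \<in> Z \<Longrightarrow> \<phi> (var z) = var z"
    using assms by (auto simp: Z_automorphism_def algebra_automorphism_def)
  have "inv_into UNIV \<phi> (var z) = var z" if "z \<in> Z" for z
    using inv_f_eq[OF bij_is_inj[OF \<phi>(2)] \<phi>(3)[OF that]] .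
  then show ?thesis
    by (simp add: Z_automorphism_def algebra_automorphism_def algebra_hom_inv \<phi>(1,2)
        bij_imp_bij_inv)
qed

lemma Z_elementary_bij: "Z_elementary X Z \<phi> \<Longrightarrow> bij \<phi>"
  by (simp add: Z_elementary_def Z_automorphism_def algebra_automorphism_def)

lemma Z_elementary_subset_Bij: "{\<psi>. Z_elementary X Z \<psi>} \<subseteq> carrier (BijGroup UNIV)"
  using Z_elementary_bij by (auto simp: BijGroup_def Bij_def)

lemma BijGroup_UNIV_mult:
  "bij \<phi> \<Longrightarrow> bij \<psi> \<Longrightarrow> \<phi> \<otimes>\<^bsub>BijGroup UNIV\<^esub> \<psi> = \<phi> \<circ> \<psi>"
  by (simp add: BijGroup_def Bij_def compose_def comp_def restrict_UNIV)

lemma BijGroup_UNIV_inv: "bij \<phi> \<Longrightarrow> inv\<^bsub>BijGroup UNIV\<^esub> \<phi> = inv_into UNIV \<phi>"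
  by (subst inv_BijGroup) (auto simp: Bij_def)

lemma Z_tame_bij: "Z_tame X Z \<phi> \<Longrightarrow> bij \<phi>"
  using group.generate_in_carrier[OF group_BijGroup Z_elementary_subset_Bij, of \<phi> X Z]
  by (simp add: Z_tame_def BijGroup_def Bij_def)

lemma Z_tame_elementary: "Z_elementary X Z \<phi> \<Longrightarrow> Z_tame X Z \<phi>"
  by (simp add: Z_tame_def generate.incl)

lemma Z_tame_id: "Z_tame X Z id"
  unfolding Z_tame_def
  using generate.one[of "BijGroup UNIV" "Collect (Z_elementary X Z)"]
  by (simp add: BijGroup_def id_def restrict_UNIV)

lemma Z_tame_comp: "Z_tame X Z \<phi> \<Longrightarrow> Z_tame X Z \<psi> \<Longrightarrow> Z_tame X Z (\<phi> \<circ> \<psi>)"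
  using generate.eng[of \<phi> "BijGroup UNIV" "Collect (Z_elementary X Z)" \<psi>]
  by (simp add: Z_tame_def[symmetric] BijGroup_UNIV_mult Z_tame_bij)

lemma Z_tame_inv: "Z_tame X Z \<phi> \<Longrightarrow> Z_tame X Z (inv_into UNIV \<phi>)"
  using group.generate_m_inv_closed[OF group_BijGroup Z_elementary_subset_Bij, of \<phi> X Z]
  by (simp add: Z_tame_def[symmetric] BijGroup_UNIV_inv Z_tame_bij)

text \<open>
  Every factor is known to be bijective here, so the group operations of \<open>BijGroup\<close> appear as
  ordinary composition and inversion of maps.
\<close>

lemma Z_tame_induct [consumes 1, case_names id elementary inverse comp]:
  assumes "Z_tame X Z \<phi>"
    and "P id"
    and elem: "\<And>\<phi>. Z_elementary X Z \<phi> \<Longrightarrow> P \<phi>"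
    and inv: "\<And>\<phi>. Z_elementary X Z \<phi> \<Longrightarrow> P \<phi> \<Longrightarrow> P (inv_into UNIV \<phi>)"
    and comp: "\<And>\<phi> \<psi>. Z_tame X Z \<phi> \<Longrightarrow> Z_tame X Z \<psi> \<Longrightarrow> P \<phi> \<Longrightarrow> P \<psi> \<Longrightarrow> P (\<phi> \<circ> \<psi>)"
  shows "P \<phi>"
  using assms(1) unfolding Z_tame_def
proof (induction rule: generate.induct)
  case one
  then show ?case using assms(2) by (simp add: BijGroup_def id_def restrict_UNIV)
next
  case (incl h)
  then show ?case using elem by simp
next
  case (inv h)
  then show ?case
    using elem assms(4) by (simp add: BijGroup_UNIV_inv Z_elementary_bij)
next
  case (eng h1 h2)
  then have "Z_tame X Z h1" "Z_tame X Z h2"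
    by (simp_all add: Z_tame_def)
  moreover from this have "h1 \<otimes>\<^bsub>BijGroup UNIV\<^esub> h2 = h1 \<circ> h2"
    by (intro BijGroup_UNIV_mult Z_tame_bij)
  ultimately show ?case
    using comp[of h1 h2] eng.IH by (simp only:)
qed

end

section \<open>Substitution in the absolutely free algebra\<close>

lemma na_add_zero [simp]: "u + 0 = u" "0 + u = u" for u :: "'v na_monomial"
  by (cases u; simp add: zero_na_monomial_def)+

lemma na_one_mult [simp]:
  fixes p :: "('v, 'k::field) nonassoc_poly"
  shows "1 \<star> p = p" "p \<star> 1 = p"
  by (simp_all add: mon_mult_def flip: single_one) (simp_all add: sum_single_keys)

primrec bracketing_value ::
    "('v \<Rightarrow> ('w, 'k::field) nonassoc_poly) \<Rightarrow> 'v bracketing \<Rightarrow> ('w, 'k) nonassoc_poly" where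
  "bracketing_value f (Leaf v) = f v"
| "bracketing_value f (Node s t) = bracketing_value f s \<star> bracketing_value f t"

primrec monomial_value ::
    "('v \<Rightarrow> ('w, 'k::field) nonassoc_poly) \<Rightarrow> 'v na_monomial \<Rightarrow> ('w, 'k) nonassoc_poly" where
  "monomial_value f Empty = 1"
| "monomial_value f (Bracketed t) = bracketing_value f t"

definition substitute ::
    "('v \<Rightarrow> ('w, 'k::field) nonassoc_poly) \<Rightarrow> ('v, 'k) nonassoc_poly \<Rightarrow> ('w, 'k) nonassoc_poly"
  where "substitute f = linear_extension (monomial_value f)"

lemma monomial_value_add: "monomial_value f (a + b) = monomial_value f a \<star> monomial_value f b"
  by (cases a; cases b) simp_all

lemma algebra_hom_substitute: "algebra_hom (substitute f)"
  unfolding substitute_def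
  by (rule algebra_hom_linear_extension) (simp_all add: zero_na_monomial_def monomial_value_add[unfolded zero_na_monomial_def])

lemma substitute_var [simp]: "substitute f (nonassoc.var v) = f v"
  by (simp add: substitute_def nonassoc.var_def)

text \<open>
  The codomain is an arbitrary algebra with a basis of monomials, so that the criterion also
  compares homomorphisms from the absolutely free algebra to its quotients.
\<close>

lemma nonassoc_hom_eqI:
  fixes \<phi> \<psi> :: "('v, 'k::field) nonassoc_poly \<Rightarrow> ('b::{plus,zero} \<Rightarrow>\<^sub>0 'k)"
  assumes "algebra_hom \<phi>" "algebra_hom \<psi>" "\<And>v. \<phi> (nonassoc.var v) = \<psi> (nonassoc.var v)"
  shows "\<phi> = \<psi>"
proof -
  have "\<phi> (Poly_Mapping.single (Bracketed t) 1) = \<psi> (Poly_Mapping.single (Bracketed t) 1)" for t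
  proof (induction t)
    case (Leaf v)
    then show ?case using assms(3)[of v] by (simp add: nonassoc.var_def)
  next
    case (Node s t)
    have "Poly_Mapping.single (Bracketed (Node s t)) (1::'k) =
        Poly_Mapping.single (Bracketed s) 1 \<star> Poly_Mapping.single (Bracketed t) 1"
      by simp
    then show ?case
      using assms(1,2) Node by (simp only: algebra_hom_def)
  qed
  moreover have "\<phi> (Poly_Mapping.single Empty 1) = \<psi> (Poly_Mapping.single Empty 1)"
    using assms(1,2) by (simp add: algebra_hom_def flip: zero_na_monomial_def)
  ultimately have "\<phi> (Poly_Mapping.single a 1) = \<psi> (Poly_Mapping.single a 1)" for a
    by (cases a) simp_all
  then show ?thesis
    using algebra_hom_eq_linear_extension[OF assms(1)] algebra_hom_eq_linear_extension[OF assms(2)]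
    by simp
qed

lemma substitute_of_hom: "algebra_hom \<phi> \<Longrightarrow> substitute (\<lambda>v. \<phi> (nonassoc.var v)) = \<phi>"
  by (rule nonassoc_hom_eqI) (simp_all add: algebra_hom_substitute)

lemma substitute_id: "substitute nonassoc.var p = p"
  by (simp add: substitute_of_hom[OF algebra_hom_id, unfolded id_apply])

lemma monomial_value_cong:
  assumes "\<And>v. v \<in> set (letters (unbracket a)) \<Longrightarrow> f v = g v"
  shows "monomial_value f a = monomial_value g a"
proof -
  have "bracketing_value f t = bracketing_value g t" if "\<And>v. v \<in> set (leaves t) \<Longrightarrow> f v = g v" for t
    using that by (induction t) auto
  then show ?thesis
    using assms by (cases a) auto
qed

lemma substitute_cong:
  assumes "\<And>v. nonassoc.depends_on p v \<Longrightarrow> f v = g v"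
  shows "substitute f p = substitute g p"
  unfolding substitute_def linear_extension_def using assms
  by (intro sum.cong refl arg_cong[where f = "mon_smult _"] monomial_value_cong)
    (auto simp: nonassoc.depends_on_def)

lemma depends_on_minus: "nonassoc.depends_on (- p) v = nonassoc.depends_on p v"
  by (simp add: nonassoc.depends_on_def)

lemma hom_fixes_independent:
  assumes "algebra_hom E" "\<And>v. v \<noteq> j \<Longrightarrow> E (nonassoc.var v) = nonassoc.var v"
    and "\<not> nonassoc.depends_on q j"
  shows "E q = q"
proof -
  have "E q = substitute (\<lambda>v. E (nonassoc.var v)) q"
    by (simp add: substitute_of_hom[OF assms(1)])
  also have "\<dots> = substitute nonassoc.var q"
    by (rule substitute_cong) (metis assms(2,3))
  finally show ?thesis by (simp add: substitute_id)
qed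

text \<open>
  Since \<open>g\<close> does not involve \<open>x\<^sub>j\<close>, it is fixed by the substitution
  \<open>x\<^sub>j \<mapsto> \<alpha> x\<^sub>j + g\<close>, whose inverse is therefore
  \<open>x\<^sub>j \<mapsto> \<alpha>\<inverse> (x\<^sub>j - g)\<close>.
\<close>

lemma exists_Z_elementary:
  fixes g :: "('v, 'k::field) nonassoc_poly"
  assumes "j \<in> X" "X \<inter> Z = {}" "\<alpha> \<noteq> 0" "\<not> nonassoc.depends_on g j"
  obtains E where "nonassoc.Z_elementary X Z E"
    "E (nonassoc.var j) = mon_smult \<alpha> (nonassoc.var j) + g"
    "\<And>v. v \<noteq> j \<Longrightarrow> E (nonassoc.var v) = nonassoc.var v"
proof -
  let ?f = "nonassoc.var(j := mon_smult \<alpha> (nonassoc.var j) + g)"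
  let ?f' = "nonassoc.var(j := mon_smult (1 / \<alpha>) (nonassoc.var j + - g))"
  let ?E = "substitute ?f"
  let ?E' = "substitute ?f'"
  have hom: "substitute f (p + q) = substitute f p + substitute f q"
    "substitute f (p - q) = substitute f p - substitute f q"
    "substitute f (mon_smult c p) = mon_smult c (substitute f p)"
    for f :: "'v \<Rightarrow> ('v, 'k) nonassoc_poly" and p q c
    using algebra_hom_substitute[of f] algebra_hom_diff by (auto simp: algebra_hom_def)
  have fixes_independent: "substitute (nonassoc.var(j := h)) q = q"
    if "\<not> nonassoc.depends_on q j" for h q :: "('v, 'k) nonassoc_poly"
    by (rule hom_fixes_independent[OF algebra_hom_substitute _ that]) simp
  have fix_g: "?E g = g" "?E (- g) = - g" "?E' g = g"
    by (simp_all add: fixes_independent assms depends_on_minus)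
  have "?E \<circ> ?E' = id"
  proof (rule nonassoc_hom_eqI[OF algebra_hom_comp[OF algebra_hom_substitute algebra_hom_substitute]
        algebra_hom_id])
    fix v
    show "(?E \<circ> ?E') (nonassoc.var v) = id (nonassoc.var v)"
      using assms(3) fix_g
      by (simp add: hom mon_smult_smult)
  qed
  moreover have "?E' \<circ> ?E = id"
  proof (rule nonassoc_hom_eqI[OF algebra_hom_comp[OF algebra_hom_substitute algebra_hom_substitute]
        algebra_hom_id])
    fix v
    show "(?E' \<circ> ?E) (nonassoc.var v) = id (nonassoc.var v)"
      using assms(3) fix_g
      by (simp add: hom mon_smult_smult)
  qed
  ultimately have "bij ?E"
    using o_bij by blast
  then have "nonassoc.Z_elementary X Z ?E"
    unfolding nonassoc.Z_elementary_def nonassoc.Z_automorphism_def algebra_automorphism_def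
    using assms by (auto simp: algebra_hom_substitute)
  then show thesis
    by (rule that) auto
qed

section \<open>Weights and degrees of nonassociative polynomials\<close>

text \<open>
  Weights assign to each variable the degree of the polynomial to be substituted for it; with all
  weights equal to one they give the ordinary length, so that a single notion serves for the
  polynomials before and after the substitution.
\<close>

definition weight :: "('v \<Rightarrow> nat) \<Rightarrow> 'v na_monomial \<Rightarrow> nat"
  where "weight d a = sum_list (map d (letters (unbracket a)))"

abbreviation len :: "'v na_monomial \<Rightarrow> nat"
  where "len \<equiv> weight (\<lambda>_. Suc 0)"

lemma weight_simps [simp]:
  "weight d Empty = 0"
  "weight d (Bracketed (Leaf v)) = d v"
  "weight d (Bracketed (Node s t)) = weight d (Bracketed s) + weight d (Bracketed t)"
  by (simp_all add: weight_def)

lemma weight_add [simp]: "weight d (a + b) = weight d a + weight d b"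
  by (cases a; cases b) simp_all

lemma weight_pos:
  assumes "\<And>v. 1 \<le> d v"
  shows "1 \<le> weight d (Bracketed t)"
  using assms by (induction t) (simp_all add: trans_le_add1)

lemma len_le_weight:
  assumes "\<And>v. 1 \<le> d v"
  shows "len a \<le> weight d a"
proof -
  have "len (Bracketed t) \<le> weight d (Bracketed t)" for t
    by (induction t) (use assms in \<open>auto intro: add_mono\<close>)
  then show ?thesis by (cases a) simp_all
qed

lemma weight_ge_occurring:
  assumes "v \<in> set (leaves t)"
  shows "d v \<le> weight d (Bracketed t)"
  using assms by (induction t) auto

lemma occurring_weight_eq_imp_Leaf:
  assumes "\<And>v. 1 \<le> d v" "v \<in> set (leaves t)" "weight d (Bracketed t) = d v"
  shows "t = Leaf v"
proof (cases t)
  case (Node s s')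
  have "1 \<le> weight d (Bracketed s)" "1 \<le> weight d (Bracketed s')"
    using weight_pos[of d] assms(1) by auto
  moreover have "d v \<le> weight d (Bracketed s) \<or> d v \<le> weight d (Bracketed s')"
    using assms(2) weight_ge_occurring[of v _ d] by (auto simp: Node)
  ultimately show ?thesis
    using assms(3) by (auto simp: Node)
qed (use assms(2) in auto)

lemma len_eq_0_iff [simp]: "len a = 0 \<longleftrightarrow> a = Empty"
  using weight_pos[of "\<lambda>_. 1"] by (cases a) (auto simp: Suc_le_eq)

lemma lookup_substitute:
  "Poly_Mapping.lookup (substitute f p) s =
    (\<Sum>a\<in>Poly_Mapping.keys p. Poly_Mapping.lookup p a * Poly_Mapping.lookup (monomial_value f a) s)"
  by (simp add: substitute_def linear_extension_def lookup_sum)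

lemma len_monomial_value:
  assumes "\<And>v s. s \<in> Poly_Mapping.keys (f v) \<Longrightarrow> len s \<le> d v"
    and "s \<in> Poly_Mapping.keys (monomial_value f a)"
  shows "len s \<le> weight d a"
proof -
  have "len s \<le> weight d (Bracketed t)" if "s \<in> Poly_Mapping.keys (bracketing_value f t)" for s t
    using that
  proof (induction t arbitrary: s)
    case (Leaf v)
    then show ?case using assms(1) by simp
  next
    case (Node t t')
    then obtain a b where "s = a + b" "a \<in> Poly_Mapping.keys (bracketing_value f t)"
      "b \<in> Poly_Mapping.keys (bracketing_value f t')"
      using keys_mon_mult[of "bracketing_value f t" "bracketing_value f t'"] by auto
    then show ?case using Node.IH by (auto intro: add_mono)
  qed
  then show ?thesis
    using assms(2) by (cases a) (auto simp: zero_na_monomial_def)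
qed

lemma len_substitute:
  assumes "\<And>v s. s \<in> Poly_Mapping.keys (f v) \<Longrightarrow> len s \<le> d v"
    and "\<And>a. a \<in> Poly_Mapping.keys p \<Longrightarrow> weight d a \<le> n"
    and "s \<in> Poly_Mapping.keys (substitute f p)"
  shows "len s \<le> n"
proof -
  have "(\<Sum>a\<in>Poly_Mapping.keys p.
      Poly_Mapping.lookup p a * Poly_Mapping.lookup (monomial_value f a) s) \<noteq> 0"
    using assms(3) by (simp add: in_keys_iff flip: lookup_substitute)
  then obtain a where a: "a \<in> Poly_Mapping.keys p"
    "Poly_Mapping.lookup p a * Poly_Mapping.lookup (monomial_value f a) s \<noteq> 0"
    by (rule sum.not_neutral_contains_not_neutral)
  then have s: "s \<in> Poly_Mapping.keys (monomial_value f a)"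
    by (simp add: in_keys_iff)
  have "len s \<le> weight d a"
    by (rule len_monomial_value[of f d s a]) (fact assms(1), fact s)
  then show ?thesis using assms(2)[OF a(1)] by simp
qed

text \<open>
  The product of two polynomials of small degree has the coefficients of a tensor product, because
  a bracketed monomial \<open>(u w)\<close> can only be split as \<open>u\<close> times \<open>w\<close>, the constant terms being
  excluded by the degree.
\<close>

lemma lookup_mult_Node:
  fixes p q :: "('v, 'k::field) nonassoc_poly"
  assumes "\<And>s. s \<in> Poly_Mapping.keys p \<Longrightarrow> len s < len (Bracketed (Node u w))"
    and "\<And>s. s \<in> Poly_Mapping.keys q \<Longrightarrow> len s < len (Bracketed (Node u w))"
  shows "Poly_Mapping.lookup (p \<star> q) (Bracketed (Node u w)) =
    Poly_Mapping.lookup p (Bracketed u) * Poly_Mapping.lookup q (Bracketed w)"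
proof -
  have split: "a + b = Bracketed (Node u w) \<longleftrightarrow> a = Bracketed u \<and> b = Bracketed w"
    if "a \<in> Poly_Mapping.keys p" "b \<in> Poly_Mapping.keys q" for a b
    using assms(1)[OF that(1)] assms(2)[OF that(2)] by (cases a; cases b) auto
  have "Poly_Mapping.lookup (p \<star> q) (Bracketed (Node u w)) =
    (\<Sum>a\<in>Poly_Mapping.keys p. \<Sum>b\<in>Poly_Mapping.keys q.
      (Poly_Mapping.lookup p a when a = Bracketed u) *
      (Poly_Mapping.lookup q b when b = Bracketed w))"
    unfolding lookup_mon_mult by (intro sum.cong refl) (auto simp: when_def split)
  also have "\<dots> = (\<Sum>a\<in>Poly_Mapping.keys p. Poly_Mapping.lookup p a when a = Bracketed u) *
      (\<Sum>b\<in>Poly_Mapping.keys q. Poly_Mapping.lookup q b when b = Bracketed w)"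
    by (simp add: sum_product)
  also have "\<dots> = Poly_Mapping.lookup p (Bracketed u) * Poly_Mapping.lookup q (Bracketed w)"
    by (simp add: when_def in_keys_iff)
  finally show ?thesis .
qed

section \<open>Algebraic independence of irreducible families\<close>

text \<open>
  When \<open>d\<close> bounds the degrees of the family \<open>f\<close>, the coefficients at monomials of length \<open>d v\<close>
  make up the leading form, so the condition says that \<open>f v\<close> loses degree when a suitable polynomial
  in the other members of the family is added. It suffices to
  allow homogeneous \<open>G\<close>, as terms of smaller weight do not reach the leading form.
\<close>

definition reducible_at ::
    "('v \<Rightarrow> nat) \<Rightarrow> ('v \<Rightarrow> ('v, 'k::field) nonassoc_poly) \<Rightarrow> 'v \<Rightarrow> bool"
  where "reducible_at d f v \<longleftrightarrow> (\<exists>G. (\<forall>a\<in>Poly_Mapping.keys G. weight d a = d v) \<and>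
    \<not> nonassoc.depends_on G v \<and>
    (\<forall>s. len s = d v \<longrightarrow> Poly_Mapping.lookup (f v + substitute f G) s = 0))"

text \<open>
  A relation among leading forms that contains \<open>x\<close> linearly can be solved for \<open>x\<close>. In a
  homogeneous polynomial of weight \<open>d x\<close> no other monomial involves \<open>x\<close>, because all weights are
  positive; so the solution is a reduction at \<open>x\<close>.
\<close>

lemma irreducible_relation_has_no_linear_term:
  fixes f :: "'v \<Rightarrow> ('v, 'k::field) nonassoc_poly"
  assumes dpos: "\<And>v. 1 \<le> d v"
    and irreducible: "\<not> reducible_at d f x"
    and homogeneous: "\<And>a. a \<in> Poly_Mapping.keys P \<Longrightarrow> weight d a = n"
    and vanish: "\<And>s. len s = n \<Longrightarrow> Poly_Mapping.lookup (substitute f P) s = 0"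
  shows "Poly_Mapping.lookup P (Bracketed (Leaf x)) = 0"
proof (rule ccontr)
  define c where "c = Poly_Mapping.lookup P (Bracketed (Leaf x))"
  assume "Poly_Mapping.lookup P (Bracketed (Leaf x)) \<noteq> 0"
  then have c: "c \<noteq> 0" and n: "d x = n"
    using homogeneous[of "Bracketed (Leaf x)"] by (simp_all add: c_def in_keys_iff)
  define G where "G = mon_smult (1 / c) P - nonassoc.var x"
  have G_lookup: "Poly_Mapping.lookup G a =
      (if a = Bracketed (Leaf x) then 0 else Poly_Mapping.lookup P a / c)" for a
    using c by (simp add: G_def lookup_minus nonassoc.var_def lookup_single c_def when_def)
  then have keys_G: "Poly_Mapping.keys G \<subseteq> Poly_Mapping.keys P - {Bracketed (Leaf x)}"
    by (auto simp: in_keys_iff split: if_splits)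
  have "\<not> nonassoc.depends_on G x"
  proof
    assume "nonassoc.depends_on G x"
    then obtain a where a: "a \<in> Poly_Mapping.keys G" "x \<in> set (letters (unbracket a))"
      by (auto simp: nonassoc.depends_on_def)
    with keys_G have "a \<in> Poly_Mapping.keys P" "a \<noteq> Bracketed (Leaf x)" by auto
    moreover obtain t where t: "a = Bracketed t" "x \<in> set (leaves t)"
    proof (cases a)
      case Empty
      with a(2) show ?thesis by simp
    next
      case (Bracketed t)
      with a(2) show ?thesis by (intro that[of t]) simp_all
    qed
    moreover have "weight d (Bracketed t) = d x"
      using homogeneous[OF \<open>a \<in> Poly_Mapping.keys P\<close>] n t(1) by simp
    then have "t = Leaf x"
      by (rule occurring_weight_eq_imp_Leaf[OF dpos t(2)])
    ultimately show False by simp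
  qed
  moreover have "f x + substitute f G = mon_smult (1 / c) (substitute f P)"
  proof -
    have "substitute f G = mon_smult (1 / c) (substitute f P) - f x"
      unfolding G_def algebra_hom_diff[OF algebra_hom_substitute]
      by (simp add: substitute_def linear_extension_smult nonassoc.var_def)
    then show ?thesis by simp
  qed
  ultimately have "reducible_at d f x"
    unfolding reducible_at_def
    using keys_G homogeneous n vanish by (intro exI[of _ G]) auto
  with irreducible show False ..
qed

text \<open>
  This is the freeness of the leading forms of an irreducible family. Looking only at the
  coefficients of \<open>P(f)\<close> at monomials of length \<open>n\<close>, instead of requiring \<open>P(f) = 0\<close>, amounts to
  replacing the \<open>f v\<close> by their homogeneous components of degree \<open>d v\<close> without having to define
  these. The induction follows the splitting of a bracketed monomial into its left and right factor.

  Reductions are excluded at the variables of \<open>X\<close> only. A relation whose linear part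
  involves the other, fixed variables and none of \<open>X\<close> has weight one, hence is a linear
  combination of variables that \<open>f\<close> fixes, and these are independent.
\<close>

lemma irreducible_independent:
  fixes f :: "'v \<Rightarrow> ('v, 'k::field) nonassoc_poly"
  assumes dpos: "\<And>v. 1 \<le> d v"
    and deg: "\<And>v s. s \<in> Poly_Mapping.keys (f v) \<Longrightarrow> len s \<le> d v"
    and fixed: "\<And>z. z \<notin> X \<Longrightarrow> f z = nonassoc.var z \<and> d z = 1"
    and irreducible: "\<And>x. x \<in> X \<Longrightarrow> \<not> reducible_at d f x"
    and homogeneous: "\<And>a. a \<in> Poly_Mapping.keys P \<Longrightarrow> weight d a = n"
    and vanish: "\<And>s. len s = n \<Longrightarrow> Poly_Mapping.lookup (substitute f P) s = 0"
  shows "P = 0"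
  using homogeneous vanish
proof (induction n arbitrary: P rule: less_induct)
  case (less n)
  let ?m = "bracketing_value f"
  have wpos: "1 \<le> weight d (Bracketed t)" for t
    by (rule weight_pos[OF dpos])
  have high: "Poly_Mapping.lookup (?m t) s = 0" if "weight d (Bracketed t) < len s" for s t
    using len_monomial_value[of f d s "Bracketed t", OF deg] that
    by (fastforce simp: in_keys_iff)
  have leafX: "Poly_Mapping.lookup P (Bracketed (Leaf x)) = 0" if "x \<in> X" for x
    by (rule irreducible_relation_has_no_linear_term[OF dpos irreducible[OF that] less.prems])
  have leaf: "Poly_Mapping.lookup P (Bracketed (Leaf v)) = 0" for v
  proof (cases "v \<in> X")
    case False
    show ?thesis
    proof (rule ccontr)
      assume nz: "Poly_Mapping.lookup P (Bracketed (Leaf v)) \<noteq> 0"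
      with less.prems(1)[of "Bracketed (Leaf v)"] fixed[OF False] have n: "n = 1"
        by (simp add: in_keys_iff)
      have "a = Bracketed (Leaf z) \<Longrightarrow> z \<notin> X" "\<exists>z. a = Bracketed (Leaf z)"
        if a: "a \<in> Poly_Mapping.keys P" for a z
      proof -
        show "z \<notin> X" if "a = Bracketed (Leaf z)"
          using leafX[of z] a that by (auto simp: in_keys_iff)
        show "\<exists>z. a = Bracketed (Leaf z)"
        proof (cases a)
          case (Bracketed t)
          then show ?thesis
          proof (cases t)
            case (Node s s')
            with less.prems(1)[OF a] Bracketed n wpos[of s] wpos[of s'] show ?thesis by simp
          qed simp
        qed (use less.prems(1)[OF a] n in simp)
      qed
      then have "monomial_value f a = Poly_Mapping.single a 1" if "a \<in> Poly_Mapping.keys P" for a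
        using that fixed by (fastforce simp: nonassoc.var_def)
      then have "substitute f P = P"
        by (simp add: substitute_def linear_extension_def sum_single_keys)
      with less.prems(2)[of "Bracketed (Leaf v)"] n nz show False by simp
    qed
  qed (rule leafX)
  show "P = 0"
  proof (cases "n = 0")
    case True
    have "a = Empty" if "a \<in> Poly_Mapping.keys P" for a
    proof (cases a)
      case (Bracketed t)
      then show ?thesis
        using less.prems(1)[OF that] True wpos[of t] by simp
    qed simp
    then have P: "P = Poly_Mapping.single Empty (Poly_Mapping.lookup P Empty)"
      by (intro poly_mapping_eqI) (auto simp: lookup_single when_def in_keys_iff)
    then have "substitute f P = mon_smult (Poly_Mapping.lookup P Empty) 1"
      by (metis linear_extension_single monomial_value.simps(1) substitute_def)
    with less.prems(2)[of Empty] True have "Poly_Mapping.lookup P Empty = 0"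
      by (simp flip: single_one add: zero_na_monomial_def)
    with P show ?thesis by simp
  next
    case False
    define c where "c s t = Poly_Mapping.lookup P (Bracketed (Node s t))" for s t
    define K where "K = {(s, t). Bracketed (Node s t) \<in> Poly_Mapping.keys P}"
    define B where "B = fst ` K \<union> snd ` K"
    have "inj (\<lambda>(s, t). Bracketed (Node s t))"
      by (auto simp: inj_def)
    then have "finite K"
      using finite_vimageI[OF finite_keys[of P], of "\<lambda>(s, t). Bracketed (Node s t)"]
      by (simp add: K_def vimage_def case_prod_unfold)
    then have B: "finite B" by (simp add: B_def)
    have c_B: "s \<in> B \<and> t \<in> B" if "c s t \<noteq> 0" for s t
    proof -
      have "(s, t) \<in> K" using that by (simp add: K_def c_def in_keys_iff)
      from imageI[OF this, of fst] imageI[OF this, of snd] show ?thesis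
        by (simp add: B_def)
    qed
    have c_weight: "weight d (Bracketed s) + weight d (Bracketed t) = n" if "c s t \<noteq> 0" for s t
      using less.prems(1)[of "Bracketed (Node s t)"] that by (simp add: c_def in_keys_iff)
    have Empty0: "Poly_Mapping.lookup P Empty = 0"
      using less.prems(1)[of Empty] False by (auto simp: in_keys_iff)
    have P_eq: "P = (\<Sum>s\<in>B. \<Sum>t\<in>B. Poly_Mapping.single (Bracketed (Node s t)) (c s t))"
    proof (rule poly_mapping_eqI)
      fix a
      show "Poly_Mapping.lookup P a = Poly_Mapping.lookup
          (\<Sum>s\<in>B. \<Sum>t\<in>B. Poly_Mapping.single (Bracketed (Node s t)) (c s t)) a"
      proof (cases "\<exists>u w. a = Bracketed (Node u w)")
        case True
        then obtain u w where a: "a = Bracketed (Node u w)" by blast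
        have "(\<Sum>s\<in>B. \<Sum>t\<in>B. c s t when s = u \<and> t = w) = (\<Sum>s\<in>B. (\<Sum>t\<in>B. c u w when t = w) when s = u)"
          by (intro sum.cong refl) (auto simp: when_def intro!: sum.cong)
        also have "\<dots> = c u w"
          using c_B[of u w] B by (auto simp: when_def)
        finally show ?thesis
          by (simp add: a lookup_sum lookup_single) (simp add: c_def)
      next
        case False
        then have "Poly_Mapping.lookup P a = 0"
          by (metis Empty0 leaf bracketing.exhaust na_monomial.exhaust)
        moreover have "Bracketed (Node s t) \<noteq> a" for s t
          using False by blast
        ultimately show ?thesis
          by (simp add: lookup_sum lookup_single when_def)
      qed
    qed
    define A where "A t = (\<Sum>s\<in>B. Poly_Mapping.single (Bracketed s) (c s t))" for t
    define \<alpha> where "\<alpha> t u = (\<Sum>s\<in>B. c s t * Poly_Mapping.lookup (?m s) (Bracketed u))" for t u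
    have A_lookup: "Poly_Mapping.lookup (A t) a =
        (case a of Empty \<Rightarrow> 0 | Bracketed s \<Rightarrow> c s t)" for a t
      using c_B[of _ t] B by (auto simp: A_def lookup_sum lookup_single when_def split: na_monomial.split)
    have A_sub: "Poly_Mapping.lookup (substitute f (A t)) (Bracketed u) = \<alpha> t u" for t u
      by (simp add: A_def substitute_def linear_extension_sum lookup_sum \<alpha>_def)
    have product: "c s t * Poly_Mapping.lookup (?m s \<star> ?m t) (Bracketed (Node u w)) =
        c s t * Poly_Mapping.lookup (?m s) (Bracketed u) * Poly_Mapping.lookup (?m t) (Bracketed w)"
      if "len (Bracketed u) + len (Bracketed w) = n" for s t u w
    proof (cases "c s t = 0")
      case False
      have lt: "weight d (Bracketed s) < n" "weight d (Bracketed t) < n"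
        using c_weight[OF False] wpos[of s] wpos[of t] by linarith+
      have "len a < n" if "a \<in> Poly_Mapping.keys (?m s) \<or> a \<in> Poly_Mapping.keys (?m t)" for a
        using that high[of s a] high[of t a] lt by (auto simp: in_keys_iff not_less) (metis leI order_less_le_trans)+
      then show ?thesis
        using that by (subst lookup_mult_Node) auto
    qed simp
    \<comment> \<open>With \<open>P\<close> the sum of the products \<open>A t\<close> times \<open>t\<close>, this reads off the vanishing top coefficients
      of \<open>P(f)\<close> at the products of \<open>u\<close> and \<open>w\<close>.\<close>
    have tensor: "(\<Sum>t\<in>B. \<alpha> t u * Poly_Mapping.lookup (?m t) (Bracketed w)) = 0"
      if uw: "len (Bracketed u) + len (Bracketed w) = n" for u w
    proof -
      have "0 = Poly_Mapping.lookup (substitute f P) (Bracketed (Node u w))"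
        using less.prems(2)[of "Bracketed (Node u w)"] uw by simp
      also have "\<dots> = (\<Sum>s\<in>B. \<Sum>t\<in>B. c s t * Poly_Mapping.lookup (?m s \<star> ?m t) (Bracketed (Node u w)))"
        by (subst P_eq) (simp add: substitute_def linear_extension_sum lookup_sum)
      also have "\<dots> = (\<Sum>s\<in>B. \<Sum>t\<in>B. c s t * Poly_Mapping.lookup (?m s) (Bracketed u) *
          Poly_Mapping.lookup (?m t) (Bracketed w))"
        by (simp only: product[OF uw])
      also have "\<dots> = (\<Sum>t\<in>B. \<alpha> t u * Poly_Mapping.lookup (?m t) (Bracketed w))"
        by (subst sum.swap) (simp add: \<alpha>_def sum_distrib_right)
      finally show ?thesis by simp
    qed
    \<comment> \<open>For fixed \<open>u\<close> the coefficients \<open>\<alpha> t u\<close> define a relation \<open>R\<close> among the right factors. In the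
      sum over all of \<open>B\<close> only the \<open>t\<close> of complementary weight matter: lighter ones do not reach
      the length of \<open>w\<close>, and for heavier ones \<open>A t\<close> is too light to reach the length of \<open>u\<close>.\<close>
    have \<alpha>0: "\<alpha> t u = 0" if t: "t \<in> B" "weight d (Bracketed t) + len (Bracketed u) = n" for t u
    proof -
      define C where "C = {t \<in> B. weight d (Bracketed t) + len (Bracketed u) = n}"
      define R where "R = (\<Sum>t\<in>C. Poly_Mapping.single (Bracketed t) (\<alpha> t u))"
      have C: "finite C" "t \<in> C" using B t by (simp_all add: C_def)
      have upos: "1 \<le> len (Bracketed u)" by (rule weight_pos) simp
      have R_lookup: "Poly_Mapping.lookup R (Bracketed t) = \<alpha> t u" if "t \<in> C" for t
        using that C(1) by (simp add: R_def lookup_sum lookup_single when_def)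
      have "R = 0"
      proof (rule less.IH[of "n - len (Bracketed u)"])
        show "n - len (Bracketed u) < n" using upos t(2) by simp
        show "weight d a = n - len (Bracketed u)" if "a \<in> Poly_Mapping.keys R" for a
        proof -
          have "Poly_Mapping.keys R \<subseteq> Bracketed ` C"
            unfolding R_def by (rule order_trans[OF Poly_Mapping.keys_sum]) (auto split: if_splits)
          with that show ?thesis by (auto simp: C_def)
        qed
        fix a :: "'v na_monomial" assume a: "len a = n - len (Bracketed u)"
        with t(2) wpos[of t] obtain w where w: "a = Bracketed w"
          by (cases a) auto
        with a t(2) have uw: "len (Bracketed u) + len (Bracketed w) = n" by simp
        have "Poly_Mapping.lookup (substitute f R) a =
            (\<Sum>t\<in>C. \<alpha> t u * Poly_Mapping.lookup (?m t) (Bracketed w))"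
          by (simp add: R_def substitute_def linear_extension_sum lookup_sum w)
        also have "\<dots> = (\<Sum>t\<in>B. \<alpha> t u * Poly_Mapping.lookup (?m t) (Bracketed w))"
        proof (rule sum.mono_neutral_left[OF B])
          show "C \<subseteq> B" by (auto simp: C_def)
          show "\<forall>t\<in>B - C. \<alpha> t u * Poly_Mapping.lookup (?m t) (Bracketed w) = 0"
          proof
            fix t assume "t \<in> B - C"
            then consider "weight d (Bracketed t) < len (Bracketed w)"
              | "n < weight d (Bracketed t) + len (Bracketed u)"
              using uw by (auto simp: C_def) linarith
            then show "\<alpha> t u * Poly_Mapping.lookup (?m t) (Bracketed w) = 0"
            proof cases
              case 2
              have "c s t * Poly_Mapping.lookup (?m s) (Bracketed u) = 0" for s
                using c_weight[of s t] high[of s "Bracketed u"] 2 by (cases "c s t = 0") auto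
              then have "\<alpha> t u = 0"
                unfolding \<alpha>_def by (intro sum.neutral ballI)
              then show ?thesis by simp
            qed (simp add: high)
          qed
        qed
        also have "\<dots> = 0" by (rule tensor[OF uw])
        finally show "Poly_Mapping.lookup (substitute f R) a = 0" .
      qed
      with R_lookup[OF C(2)] show ?thesis by simp
    qed
    \<comment> \<open>The top coefficients of \<open>A t\<close> evaluated at \<open>f\<close> now vanish, so the induction hypothesis
      also applies to the left factor.\<close>
    have "c s t = 0" for s t
    proof (rule ccontr)
      assume st: "c s t \<noteq> 0"
      have "A t = 0"
      proof (rule less.IH[of "n - weight d (Bracketed t)"])
        show "n - weight d (Bracketed t) < n"
          using c_weight[OF st] wpos[of t] by linarith
        show "weight d a = n - weight d (Bracketed t)" if "a \<in> Poly_Mapping.keys (A t)" for a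
        proof (cases a)
          case (Bracketed r)
          with that have "c r t \<noteq> 0" by (simp add: in_keys_iff A_lookup)
          from c_weight[OF this] show ?thesis by (simp add: Bracketed)
        qed (use that in \<open>simp add: in_keys_iff A_lookup\<close>)
        fix a :: "'v na_monomial" assume a: "len a = n - weight d (Bracketed t)"
        with c_weight[OF st] wpos[of s] obtain u where u: "a = Bracketed u"
          by (cases a) auto
        show "Poly_Mapping.lookup (substitute f (A t)) a = 0"
          using \<alpha>0[of t u] a c_B[OF st] c_weight[OF st] by (simp add: u A_sub)
      qed
      with A_lookup[of t "Bracketed s"] st show False by simp
    qed
    then show ?thesis by (subst P_eq) simp
  qed
qed

section \<open>Affine automorphisms\<close>

abbreviation affine :: "('v, 'k::field) nonassoc_poly \<Rightarrow> bool"
  where "affine p \<equiv> \<forall>s\<in>Poly_Mapping.keys p. len s \<le> 1"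

abbreviation coeff_var :: "('v, 'k::field) nonassoc_poly \<Rightarrow> 'v \<Rightarrow> 'k"
  where "coeff_var p v \<equiv> Poly_Mapping.lookup p (Bracketed (Leaf v))"

lemma len_le_1_cases:
  assumes "len s \<le> 1"
  obtains "s = Empty" | v where "s = Bracketed (Leaf v)"
proof (cases s)
  case (Bracketed t)
  show thesis
  proof (cases t)
    case (Node u w)
    with assms Bracketed weight_pos[of "\<lambda>_. 1" u] weight_pos[of "\<lambda>_. 1" w] show thesis by simp
  qed (use Bracketed that in simp)
qed (use that in simp)

lemma affine_split_var:
  assumes "affine p"
  shows "\<not> nonassoc.depends_on (p - mon_smult (coeff_var p j) (nonassoc.var j)) j"
proof
  let ?q = "p - mon_smult (coeff_var p j) (nonassoc.var j)"
  have lookup: "Poly_Mapping.lookup ?q s =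
      (if s = Bracketed (Leaf j) then 0 else Poly_Mapping.lookup p s)" for s
    by (simp add: nonassoc.var_def lookup_minus lookup_single when_def)
  assume "nonassoc.depends_on ?q j"
  then obtain s where s: "s \<in> Poly_Mapping.keys ?q" "j \<in> set (letters (unbracket s))"
    by (auto simp: nonassoc.depends_on_def)
  then have "s \<in> Poly_Mapping.keys p" "s \<noteq> Bracketed (Leaf j)"
    using lookup[of s] by (auto simp: in_keys_iff split: if_splits)
  with assms have "len s \<le> 1" by simp
  then show False
    by (cases rule: len_le_1_cases) (use s(2) \<open>s \<noteq> _\<close> in auto)
qed

lemma affine_hom:
  assumes "algebra_hom E" "\<And>v. affine (E (nonassoc.var v))" "affine p"
  shows "affine (E p)"
proof
  fix s assume "s \<in> Poly_Mapping.keys (E p)"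
  then have s: "s \<in> Poly_Mapping.keys (substitute (\<lambda>v. E (nonassoc.var v)) p)"
    by (simp add: substitute_of_hom[OF assms(1)])
  show "len s \<le> 1"
    by (rule len_substitute[where d = "\<lambda>_. 1", OF _ _ s]) (use assms(2,3) in auto)
qed

lemma affine_var: "affine (nonassoc.var v)"
  by (auto simp: nonassoc.var_def)

lemma affine_smult: "affine p \<Longrightarrow> affine (mon_smult c p)"
  using keys_mon_smult[of c p] by auto

lemma affine_add: "affine p \<Longrightarrow> affine q \<Longrightarrow> affine (p + q)"
  using Poly_Mapping.keys_add[of p q] by auto

lemma affine_diff: "affine p \<Longrightarrow> affine q \<Longrightarrow> affine (p - q)"
  using Poly_Mapping.keys_diff[of p q] by auto

lemma Z_tame_left_cancel:
  fixes E \<Psi> :: "('v, 'k::field) nonassoc_poly \<Rightarrow> ('v, 'k) nonassoc_poly"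
  assumes "nonassoc.Z_elementary X Z E" "nonassoc.Z_tame X Z (E \<circ> \<Psi>)"
  shows "nonassoc.Z_tame X Z \<Psi>"
proof -
  have "inv_into UNIV E \<circ> (E \<circ> \<Psi>) = \<Psi>"
    using nonassoc.Z_elementary_bij[OF assms(1)] by (simp add: fun_eq_iff bij_is_inj)
  then show ?thesis
    using nonassoc.Z_tame_comp[OF nonassoc.Z_tame_inv[OF nonassoc.Z_tame_elementary[OF assms(1)]]
        assms(2)] by simp
qed

lemma Z_tame_right_cancel:
  fixes E \<Psi> :: "('v, 'k::field) nonassoc_poly \<Rightarrow> ('v, 'k) nonassoc_poly"
  assumes "nonassoc.Z_elementary X Z E" "nonassoc.Z_tame X Z (\<Psi> \<circ> E)"
  shows "nonassoc.Z_tame X Z \<Psi>"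
proof -
  have "(\<Psi> \<circ> E) \<circ> inv_into UNIV E = \<Psi>"
    using nonassoc.Z_elementary_bij[OF assms(1)]
    by (simp add: fun_eq_iff bij_is_surj surj_f_inv_f)
  then show ?thesis
    using nonassoc.Z_tame_comp[OF assms(2)
        nonassoc.Z_tame_inv[OF nonassoc.Z_tame_elementary[OF assms(1)]]] by simp
qed

text \<open>
  Gaussian elimination, by induction on the number of variables that \<open>\<Psi>\<close> moves. If the
  coefficient of \<open>x\<close> in \<open>\<Psi> x\<close> is nonzero, an elementary automorphism sends \<open>\<Psi> x\<close> back to \<open>x\<close>
  and disturbs no variable fixed so far. Otherwise \<open>\<Psi> x\<close> contains another moved variable \<open>w\<close>, and
  \<open>w \<mapsto> w + x\<close> creates the missing pivot.
\<close>

lemma affine_automorphism_tame: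
  fixes \<Psi> :: "('v, 'k::field) nonassoc_poly \<Rightarrow> ('v, 'k) nonassoc_poly"
  assumes "finite X" "X \<inter> Z = {}" "X \<union> Z = UNIV"
    and "nonassoc.Z_automorphism Z \<Psi>" "\<And>v. affine (\<Psi> (nonassoc.var v))"
  shows "nonassoc.Z_tame X Z \<Psi>"
  using assms(4,5)
proof (induction "card {v. \<Psi> (nonassoc.var v) \<noteq> nonassoc.var v}" arbitrary: \<Psi> rule: less_induct)
  case less
  define M where "M = {v. \<Psi> (nonassoc.var v) \<noteq> nonassoc.var v}"
  have homs: "algebra_hom \<psi>" "bij \<psi>" if "nonassoc.Z_automorphism Z \<psi>"
    for \<psi> :: "('v, 'k) nonassoc_poly \<Rightarrow> ('v, 'k) nonassoc_poly"
    using that by (auto simp: nonassoc.Z_automorphism_def algebra_automorphism_def)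
  have add: "\<psi> (p + q) = \<psi> p + \<psi> q" and smult: "\<psi> (mon_smult c p) = mon_smult c (\<psi> p)"
    if "algebra_hom \<psi>" for \<psi> :: "('v, 'k) nonassoc_poly \<Rightarrow> ('v, 'k) nonassoc_poly" and p q c
    using that by (auto simp: algebra_hom_def)
  have "M \<subseteq> X"
    using less.prems(1) assms(3) by (auto simp: M_def nonassoc.Z_automorphism_def)
  then have "finite M" using assms(1) finite_subset by blast
  show ?case
  proof (cases "M = {}")
    case True
    then have "\<Psi> = id"
      by (intro nonassoc_hom_eqI homs(1)[OF less.prems(1)] algebra_hom_id) (auto simp: M_def)
    then show ?thesis by (simp add: nonassoc.Z_tame_id)
  next
    case False
    then obtain x where x: "x \<in> M" by blast
    then have "x \<in> X" using \<open>M \<subseteq> X\<close> by blast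
    \<comment> \<open>Stated for any \<open>\<psi>\<close> moving no more variables than \<open>\<Psi>\<close>, since it is also
      applied after a pivot has been created.\<close>
    have pivot: "nonassoc.Z_tame X Z \<psi>"
      if \<psi>: "nonassoc.Z_automorphism Z \<psi>" "\<And>v. affine (\<psi> (nonassoc.var v))"
        and moved: "{v. \<psi> (nonassoc.var v) \<noteq> nonassoc.var v} \<subseteq> M"
        and b: "coeff_var (\<psi> (nonassoc.var x)) x \<noteq> 0"
      for \<psi> :: "('v, 'k) nonassoc_poly \<Rightarrow> ('v, 'k) nonassoc_poly"
    proof -
      define p where "p = \<psi> (nonassoc.var x)"
      define b where "b = coeff_var p x"
      define q where "q = p - mon_smult b (nonassoc.var x)"
      have b0: "b \<noteq> 0" using b by (simp add: b_def p_def)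
      have p: "affine p" unfolding p_def by (rule \<psi>(2))
      have q_indep: "\<not> nonassoc.depends_on q x"
        using affine_split_var[OF p, of x] by (simp add: q_def b_def)
      have q: "affine q"
        unfolding q_def by (intro affine_diff p affine_smult affine_var)
      have "\<not> nonassoc.depends_on (mon_smult (- 1 / b) q) x"
        using q_indep keys_mon_smult[of "- 1 / b" q] by (auto simp: nonassoc.depends_on_def)
      then obtain E where E: "nonassoc.Z_elementary X Z E"
        "E (nonassoc.var x) = mon_smult (1 / b) (nonassoc.var x) + mon_smult (- 1 / b) q"
        "\<And>v. v \<noteq> x \<Longrightarrow> E (nonassoc.var v) = nonassoc.var v"
        using exists_Z_elementary[of x X Z "1 / b" "mon_smult (- 1 / b) q"] \<open>x \<in> X\<close> assms(2) b0
        by auto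
      have E_aut: "nonassoc.Z_automorphism Z E"
        using E(1) by (simp add: nonassoc.Z_elementary_def)
      have "E p = E (mon_smult b (nonassoc.var x) + q)"
        by (simp add: q_def)
      also have "\<dots> = mon_smult b (mon_smult (1 / b) (nonassoc.var x) + mon_smult (- 1 / b) q) + q"
        by (simp add: add[OF homs(1)[OF E_aut]] smult[OF homs(1)[OF E_aut]] E(2)
            hom_fixes_independent[OF homs(1)[OF E_aut] E(3) q_indep])
      also have "\<dots> = nonassoc.var x"
        using b0 by (simp add: mon_smult_add_right mon_smult_smult mon_smult_minus_one)
      finally have Ex: "E (\<psi> (nonassoc.var x)) = nonassoc.var x" by (simp add: p_def)
      have E_affine: "affine (E (nonassoc.var v))" for v
      proof (cases "v = x")
        case False
        show ?thesis unfolding E(3)[OF False] by (rule affine_var)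
      next
        case True
        show ?thesis unfolding True E(2) by (intro affine_add affine_smult affine_var q)
      qed
      have "nonassoc.Z_tame X Z (E \<circ> \<psi>)"
      proof (rule less.hyps)
        have "{v. (E \<circ> \<psi>) (nonassoc.var v) \<noteq> nonassoc.var v} \<subseteq> M - {x}"
        proof
          fix v assume v: "v \<in> {v. (E \<circ> \<psi>) (nonassoc.var v) \<noteq> nonassoc.var v}"
          then have "v \<noteq> x" using Ex by auto
          moreover have "v \<in> M"
          proof (rule ccontr)
            assume "v \<notin> M"
            then have "\<psi> (nonassoc.var v) = nonassoc.var v" using moved by blast
            with v \<open>v \<noteq> x\<close> E(3) show False by simp
          qed
          ultimately show "v \<in> M - {x}" by simp
        qed
        also have "\<dots> \<subset> M" using x by blast
        finally show "card {v. (E \<circ> \<psi>) (nonassoc.var v) \<noteq> nonassoc.var v}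
            < card {v. \<Psi> (nonassoc.var v) \<noteq> nonassoc.var v}"
          unfolding M_def[symmetric] by (rule psubset_card_mono[OF \<open>finite M\<close>])
        show "nonassoc.Z_automorphism Z (E \<circ> \<psi>)"
          by (rule nonassoc.Z_automorphism_comp[OF E_aut \<psi>(1)])
        show "affine ((E \<circ> \<psi>) (nonassoc.var v))" for v
          unfolding comp_apply by (rule affine_hom[OF homs(1)[OF E_aut] E_affine \<psi>(2)])
      qed
      then show ?thesis by (rule Z_tame_left_cancel[OF E(1)])
    qed
    define p where "p = \<Psi> (nonassoc.var x)"
    show ?thesis
    proof (cases "coeff_var p x = 0")
      case False
      then show ?thesis
        using less.prems by (intro pivot) (auto simp: M_def p_def)
    next
      case True
      \<comment> \<open>If \<open>\<Psi> x\<close> contained fixed variables only, then \<open>\<Psi>\<close> would fix \<open>\<Psi> x\<close>, and by injectivity \<open>x\<close>.\<close>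
      have "\<exists>w\<in>M. coeff_var p w \<noteq> 0"
      proof (rule ccontr)
        assume none: "\<not> (\<exists>w\<in>M. coeff_var p w \<noteq> 0)"
        have "\<Psi> p = substitute (\<lambda>v. \<Psi> (nonassoc.var v)) p"
          by (simp add: substitute_of_hom[OF homs(1)[OF less.prems(1)]])
        also have "\<dots> = substitute nonassoc.var p"
        proof (rule substitute_cong)
          fix v assume "nonassoc.depends_on p v"
          then obtain s where s: "s \<in> Poly_Mapping.keys p" "v \<in> set (letters (unbracket s))"
            by (auto simp: nonassoc.depends_on_def)
          then have "len s \<le> 1" using less.prems(2)[of x] by (simp add: p_def)
          then have "s = Bracketed (Leaf v)"
            by (cases rule: len_le_1_cases) (use s(2) in auto)
          with none s(1) have "v \<notin> M" by (auto simp: in_keys_iff)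
          then show "\<Psi> (nonassoc.var v) = nonassoc.var v" by (simp add: M_def)
        qed
        finally have "\<Psi> p = \<Psi> (nonassoc.var x)" by (simp add: substitute_id p_def)
        then have "p = nonassoc.var x"
          using homs(2)[OF less.prems(1)] by (simp add: bij_is_inj inj_eq)
        with x show False by (simp add: M_def p_def)
      qed
      then obtain w where w: "w \<in> M" "coeff_var p w \<noteq> 0" by blast
      with True have "w \<noteq> x" by auto
      then have "\<not> nonassoc.depends_on (nonassoc.var x :: ('v, 'k) nonassoc_poly) w"
        by (auto simp: nonassoc.depends_on_def nonassoc.var_def)
      then obtain E :: "('v, 'k) nonassoc_poly \<Rightarrow> ('v, 'k) nonassoc_poly" where
        E: "nonassoc.Z_elementary X Z E"
        "E (nonassoc.var w) = nonassoc.var w + nonassoc.var x"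
        "\<And>v. v \<noteq> w \<Longrightarrow> E (nonassoc.var v) = nonassoc.var v"
        using exists_Z_elementary[of w X Z "1" "nonassoc.var x :: ('v, 'k) nonassoc_poly"]
          w(1) \<open>M \<subseteq> X\<close> assms(2) by auto
      have E_aut: "nonassoc.Z_automorphism Z E"
        using E(1) by (simp add: nonassoc.Z_elementary_def)
      have E_affine: "affine (E (nonassoc.var v))" for v
      proof (cases "v = w")
        case False
        show ?thesis unfolding E(3)[OF False] by (rule affine_var)
      next
        case True
        show ?thesis unfolding True E(2) by (intro affine_add affine_var)
      qed
      let ?b = "coeff_var p w"
      let ?q = "p - mon_smult ?b (nonassoc.var w)"
      have "affine p" unfolding p_def by (rule less.prems(2))
      have E_q: "E ?q = ?q"
        using hom_fixes_independent[of E w ?q] homs(1)[OF E_aut] E(3)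
          affine_split_var[OF \<open>affine p\<close>, of w] by blast
      have "E p = E (mon_smult ?b (nonassoc.var w) + ?q)"
        by simp
      also have "\<dots> = mon_smult ?b (nonassoc.var w + nonassoc.var x) + ?q"
        unfolding add[OF homs(1)[OF E_aut]] smult[OF homs(1)[OF E_aut]] E(2) E_q ..
      also have "\<dots> = p + mon_smult ?b (nonassoc.var x)"
        by (simp add: mon_smult_add_right)
      finally have "coeff_var (E p) x = ?b"
        using True by (simp add: lookup_add nonassoc.var_def)
      with w(2) have b: "coeff_var ((E \<circ> \<Psi>) (nonassoc.var x)) x \<noteq> 0"
        by (simp add: p_def)
      have "nonassoc.Z_tame X Z (E \<circ> \<Psi>)"
      proof (rule pivot[of "E \<circ> \<Psi>", OF _ _ _ b])
        show "nonassoc.Z_automorphism Z (E \<circ> \<Psi>)"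
          by (rule nonassoc.Z_automorphism_comp[OF E_aut less.prems(1)])
        show "affine ((E \<circ> \<Psi>) (nonassoc.var v))" for v
          unfolding comp_apply by (rule affine_hom[OF homs(1)[OF E_aut] E_affine less.prems(2)])
        show "{v. (E \<circ> \<Psi>) (nonassoc.var v) \<noteq> nonassoc.var v} \<subseteq> M"
        proof
          fix v assume v: "v \<in> {v. (E \<circ> \<Psi>) (nonassoc.var v) \<noteq> nonassoc.var v}"
          show "v \<in> M"
          proof (rule ccontr)
            assume "v \<notin> M"
            then have "\<Psi> (nonassoc.var v) = nonassoc.var v" "v \<noteq> w"
              using w(1) by (auto simp: M_def)
            with v E(3) show False by simp
          qed
        qed
      qed
      then show ?thesis by (rule Z_tame_left_cancel[OF E(1)])
    qed
  qed
qed

section \<open>Tameness of automorphisms of the absolutely free algebra\<close>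

text \<open>Inserting \<open>0\<close> gives the zero polynomial degree \<open>0\<close>.\<close>

definition na_degree :: "('v, 'k::field) nonassoc_poly \<Rightarrow> nat"
  where "na_degree p = Max (insert 0 (len ` Poly_Mapping.keys p))"

lemma len_le_na_degree: "s \<in> Poly_Mapping.keys p \<Longrightarrow> len s \<le> na_degree p"
  by (simp add: na_degree_def)

lemma na_degree_less:
  assumes "0 < n" "\<And>s. s \<in> Poly_Mapping.keys p \<Longrightarrow> len s < n"
  shows "na_degree p < n"
  using assms by (simp add: na_degree_def)

lemma na_degree_var: "na_degree (nonassoc.var v) = 1"
  by (simp add: na_degree_def nonassoc.var_def)

text \<open>Otherwise the image is a scalar, which is also the image of that scalar.\<close>

lemma na_degree_image_pos:
  assumes "algebra_hom \<Phi>" "inj \<Phi>"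
  shows "1 \<le> na_degree (\<Phi> (nonassoc.var v))"
proof (rule ccontr)
  let ?p = "\<Phi> (nonassoc.var v)"
  assume "\<not> 1 \<le> na_degree ?p"
  then have "na_degree ?p = 0" by linarith
  then have "s = Empty" if "s \<in> Poly_Mapping.keys ?p" for s
    using len_le_na_degree[OF that] by simp
  then have "?p = Poly_Mapping.single 0 (Poly_Mapping.lookup ?p 0)"
    by (intro poly_mapping_eqI) (auto simp: lookup_single when_def in_keys_iff zero_na_monomial_def)
  also have "\<dots> = mon_smult (Poly_Mapping.lookup ?p 0) 1"
    by (simp flip: single_one)
  also have "\<dots> = \<Phi> (mon_smult (Poly_Mapping.lookup ?p 0) 1)"
    using assms(1) by (simp add: algebra_hom_def)
  finally have "nonassoc.var v = mon_smult (Poly_Mapping.lookup ?p 0) 1"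
    by (rule injD[OF assms(2)])
  then have "coeff_var (nonassoc.var v) v = coeff_var (mon_smult (Poly_Mapping.lookup ?p 0) 1) v"
    by simp
  then show False
    by (simp add: nonassoc.var_def lookup_single zero_na_monomial_def flip: single_one)
qed

text \<open>
  For \<open>y = \<Phi>\<inverse> x\<close> the value \<open>y(f)\<close> is the variable \<open>x\<close>, of degree one. By independence of the
  leading forms the component of \<open>y\<close> of top weight survives in \<open>y(f)\<close>, so the weight of \<open>y\<close> is at
  most one; and the length of a monomial is at most its weight.
\<close>

lemma irreducible_imp_affine_inverse:
  fixes \<Phi> :: "('v, 'k::field) nonassoc_poly \<Rightarrow> ('v, 'k) nonassoc_poly"
  assumes \<Phi>: "nonassoc.Z_automorphism Z \<Phi>" and UNIV: "X \<union> Z = UNIV"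
    and irreducible: "\<And>x. x \<in> X \<Longrightarrow>
      \<not> reducible_at (\<lambda>v. na_degree (\<Phi> (nonassoc.var v))) (\<lambda>v. \<Phi> (nonassoc.var v)) x"
  shows "affine (inv_into UNIV \<Phi> (nonassoc.var x))"
proof -
  let ?f = "\<lambda>v. \<Phi> (nonassoc.var v)"
  let ?d = "\<lambda>v. na_degree (?f v)"
  have hom: "algebra_hom \<Phi>" and bij: "bij \<Phi>"
    and fixZ: "\<And>z. z \<in> Z \<Longrightarrow> \<Phi> (nonassoc.var z) = nonassoc.var z"
    using \<Phi> by (auto simp: nonassoc.Z_automorphism_def algebra_automorphism_def)
  have dpos: "1 \<le> ?d v" for v
    by (rule na_degree_image_pos[OF hom bij_is_inj[OF bij]])
  have deg: "len s \<le> ?d v" if "s \<in> Poly_Mapping.keys (?f v)" for s v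
    using that by (rule len_le_na_degree)
  have fixed: "?f z = nonassoc.var z \<and> ?d z = 1" if "z \<notin> X" for z
  proof -
    have "z \<in> Z" using that UNIV by blast
    then show ?thesis by (simp add: fixZ na_degree_var)
  qed
  define y where "y = inv_into UNIV \<Phi> (nonassoc.var x)"
  have y: "substitute ?f y = nonassoc.var x"
    using bij by (simp add: substitute_of_hom[OF hom] y_def bij_is_surj surj_f_inv_f)
  define n where "n = Max (insert 0 (weight ?d ` Poly_Mapping.keys y))"
  have weight_y: "weight ?d a \<le> n" if "a \<in> Poly_Mapping.keys y" for a
    using that by (simp add: n_def)
  have "n \<le> 1"
  proof (rule ccontr)
    assume "\<not> n \<le> 1"
    then have n: "1 < n" by simp
    have "n \<in> insert 0 (weight ?d ` Poly_Mapping.keys y)"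
      unfolding n_def by (rule Max_in) auto
    with n obtain a where a: "a \<in> Poly_Mapping.keys y" "weight ?d a = n" by auto
    define K where "K = {a \<in> Poly_Mapping.keys y. weight ?d a = n}"
    define P where "P = (\<Sum>a\<in>K. Poly_Mapping.single a (Poly_Mapping.lookup y a))"
    have K: "finite K" by (simp add: K_def)
    have P_lookup: "Poly_Mapping.lookup P a = (if a \<in> K then Poly_Mapping.lookup y a else 0)" for a
      using K by (simp add: P_def lookup_sum lookup_single when_def)
    have "P \<noteq> 0"
      using P_lookup[of a] a by (auto simp: K_def in_keys_iff)
    have P_weight: "weight ?d a = n" if "a \<in> Poly_Mapping.keys P" for a
      using that by (auto simp: in_keys_iff P_lookup K_def split: if_splits)
    have "\<not> (\<forall>s. len s = n \<longrightarrow> Poly_Mapping.lookup (substitute ?f P) s = 0)"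
      using irreducible_independent[of ?d ?f X P n, OF dpos deg fixed irreducible P_weight] \<open>P \<noteq> 0\<close>
      by blast
    then obtain s where s: "len s = n" "Poly_Mapping.lookup (substitute ?f P) s \<noteq> 0"
      by blast
    have rest: "Poly_Mapping.lookup (substitute ?f (y - P)) s = 0"
    proof (rule ccontr)
      assume nz: "Poly_Mapping.lookup (substitute ?f (y - P)) s \<noteq> 0"
      have "len s \<le> n - 1"
      proof (rule len_substitute[of ?f ?d])
        show "s \<in> Poly_Mapping.keys (substitute ?f (y - P))"
          using nz by (simp add: in_keys_iff)
        fix a assume "a \<in> Poly_Mapping.keys (y - P)"
        then have "a \<in> Poly_Mapping.keys y" "weight ?d a \<noteq> n"
          by (auto simp: in_keys_iff lookup_minus P_lookup K_def split: if_splits)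
        with weight_y[of a] show "weight ?d a \<le> n - 1" by simp
      qed (rule deg)
      with s(1) n show False by simp
    qed
    have "substitute ?f P = nonassoc.var x - substitute ?f (y - P)"
      by (simp add: algebra_hom_diff[OF algebra_hom_substitute] y)
    with s(2) rest have "Poly_Mapping.lookup (nonassoc.var x :: ('v, 'k) nonassoc_poly) s \<noteq> 0"
      by (simp add: lookup_minus)
    then have "len s = 1"
      by (auto simp: nonassoc.var_def lookup_single when_def split: if_splits)
    with s(1) n show False by simp
  qed
  then show ?thesis
    using weight_y len_le_weight[of ?d, OF dpos] unfolding y_def[symmetric]
    by (meson order_trans)
qed

text \<open>
  Induction on the sum of the degrees of the images of \<open>X\<close>. A reduction at \<open>x\<close> is the right
  composition with \<open>x \<mapsto> x + G\<close>, since this replaces \<open>f x\<close> by \<open>f x + G(f)\<close> and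
  keeps the other images.
\<close>

lemma nonassoc_automorphism_tame:
  fixes \<Phi> :: "('v, 'k::field) nonassoc_poly \<Rightarrow> ('v, 'k) nonassoc_poly"
  assumes X: "finite X" "X \<inter> Z = {}" "X \<union> Z = UNIV"
    and "nonassoc.Z_automorphism Z \<Phi>"
  shows "nonassoc.Z_tame X Z \<Phi>"
  using assms(4)
proof (induction "\<Sum>x\<in>X. na_degree (\<Phi> (nonassoc.var x))" arbitrary: \<Phi> rule: less_induct)
  case less
  let ?f = "\<lambda>v. \<Phi> (nonassoc.var v)"
  let ?d = "\<lambda>v. na_degree (?f v)"
  have hom: "algebra_hom \<Phi>" and bij: "bij \<Phi>"
    using less.prems by (auto simp: nonassoc.Z_automorphism_def algebra_automorphism_def)
  show ?case
  proof (cases "\<exists>x\<in>X. reducible_at ?d ?f x")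
    case False
    have "nonassoc.Z_tame X Z (inv_into UNIV \<Phi>)"
      by (rule affine_automorphism_tame[OF X nonassoc.Z_automorphism_inv[OF less.prems]
            irreducible_imp_affine_inverse[OF less.prems X(3)]]) (use False in blast)
    from nonassoc.Z_tame_inv[OF this] show ?thesis
      by (simp add: inv_inv_eq[OF bij])
  next
    case True
    then obtain x G where x: "x \<in> X" and G: "\<And>a. a \<in> Poly_Mapping.keys G \<Longrightarrow> weight ?d a = ?d x"
      "\<not> nonassoc.depends_on G x"
      "\<And>s. len s = ?d x \<Longrightarrow> Poly_Mapping.lookup (?f x + substitute ?f G) s = 0"
      unfolding reducible_at_def by blast
    obtain E where E: "nonassoc.Z_elementary X Z E"
      "E (nonassoc.var x) = nonassoc.var x + G"
      "\<And>v. v \<noteq> x \<Longrightarrow> E (nonassoc.var v) = nonassoc.var v"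
      using exists_Z_elementary[of x X Z 1 G] x X(2) G(2) by auto
    have E_aut: "nonassoc.Z_automorphism Z E"
      using E(1) by (simp add: nonassoc.Z_elementary_def)
    have new: "\<Phi> (E (nonassoc.var x)) = ?f x + substitute ?f G"
      using hom by (simp add: E(2) substitute_of_hom) (simp add: algebra_hom_def)
    have "na_degree (\<Phi> (E (nonassoc.var x))) < ?d x"
    proof (rule na_degree_less)
      show "0 < ?d x"
        using na_degree_image_pos[OF hom bij_is_inj[OF bij], of x] by simp
      fix s assume s: "s \<in> Poly_Mapping.keys (\<Phi> (E (nonassoc.var x)))"
      then have "len s \<noteq> ?d x"
        using G(3)[of s] by (auto simp: new in_keys_iff)
      moreover have "s \<in> Poly_Mapping.keys (?f x) \<or> s \<in> Poly_Mapping.keys (substitute ?f G)"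
        using s Poly_Mapping.keys_add[of "?f x" "substitute ?f G"] by (auto simp: new)
      then have "len s \<le> ?d x"
      proof
        assume "s \<in> Poly_Mapping.keys (substitute ?f G)"
        then show ?thesis
          by (rule len_substitute[of ?f ?d, rotated 2]) (simp_all add: G(1) len_le_na_degree)
      qed (rule len_le_na_degree)
      ultimately show "len s < ?d x" by simp
    qed
    moreover have "na_degree (\<Phi> (E (nonassoc.var v))) \<le> ?d v" if "v \<noteq> x" for v
      using E(3)[OF that] by simp
    ultimately have "(\<Sum>v\<in>X. na_degree ((\<Phi> \<circ> E) (nonassoc.var v))) < (\<Sum>v\<in>X. ?d v)"
      using x X(1) by (intro sum_strict_mono_ex1) (auto, metis less_imp_le)
    then have "nonassoc.Z_tame X Z (\<Phi> \<circ> E)"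
      by (rule less.hyps[OF _ nonassoc.Z_automorphism_comp[OF less.prems E_aut]])
    then show ?thesis by (rule Z_tame_right_cancel[OF E(1)])
  qed
qed

section \<open>Descent of tame automorphisms\<close>

text \<open>
  The quotient algebra enters through three properties of the monomial map \<open>h\<close>: it is a surjective
  homomorphism, it preserves the set of occurring variables, and the quotient is free on the
  variables within its own class of algebras. Freeness provides, for each homomorphism upstairs,
  one that it induces downstairs; as \<open>h\<close> is surjective, induced maps are unique, which makes
  the map induced by an automorphism bijective and identifies the product of the induced factors
  with \<open>\<phi>\<close>. Preservation of occurring variables keeps elementary automorphisms elementary.
\<close>

lemma (in polynomial_algebra) tame_descends:
  fixes h :: "'v na_monomial \<Rightarrow> 'b"
    and \<Phi> :: "('v, 'k::field) nonassoc_poly \<Rightarrow> ('v, 'k) nonassoc_poly"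
    and \<phi> :: "('b \<Rightarrow>\<^sub>0 'k) \<Rightarrow> ('b \<Rightarrow>\<^sub>0 'k)"
  assumes h: "h 0 = 0" "\<And>a b. h (a + b) = h a + h b" "surj h"
    and gen: "\<And>v. gen v = h (Bracketed (Leaf v))"
    and occ: "\<And>a. occ (h a) = set (letters (unbracket a))"
    and universal: "\<And>f :: 'v \<Rightarrow> ('b \<Rightarrow>\<^sub>0 'k). \<exists>e. algebra_hom e \<and> (\<forall>v. e (var v) = f v)"
    and tame: "nonassoc.Z_tame X Z \<Phi>"
    and induces: "induces_via (mon_map h) \<Phi> \<phi>"
  shows "Z_tame X Z \<phi>"
proof -
  let ?\<pi> = "mon_map h :: ('v, 'k) nonassoc_poly \<Rightarrow> ('b \<Rightarrow>\<^sub>0 'k)"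
  have hom\<pi>: "algebra_hom ?\<pi>"
    by (rule algebra_hom_mon_map[OF h(1,2)])
  have surj\<pi>: "surj ?\<pi>"
    by (rule surj_mon_map[OF h(3)])
  have \<pi>_var: "?\<pi> (nonassoc.var v) = var v" for v
    by (simp add: nonassoc.var_def var_def gen)
  have induced: "\<exists>e. algebra_hom e \<and> e \<circ> ?\<pi> = ?\<pi> \<circ> E" if E: "algebra_hom E" for E
  proof -
    obtain e where e: "algebra_hom e" "\<And>v. e (var v) = ?\<pi> (E (nonassoc.var v))"
      using universal[of "\<lambda>v. ?\<pi> (E (nonassoc.var v))"] by blast
    have "e \<circ> ?\<pi> = ?\<pi> \<circ> E"
      by (rule nonassoc_hom_eqI) (simp_all add: algebra_hom_comp hom\<pi> E e \<pi>_var)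
    with e(1) show ?thesis by blast
  qed
  have cancel: "e = e'" if "e \<circ> ?\<pi> = e' \<circ> ?\<pi>" for e e' :: "('b \<Rightarrow>\<^sub>0 'k) \<Rightarrow> ('b \<Rightarrow>\<^sub>0 'k)"
    using that surj\<pi> by (metis surj_fun_eq)
  have "\<exists>\<phi>'. Z_tame X Z \<phi>' \<and> \<phi>' \<circ> ?\<pi> = ?\<pi> \<circ> \<Phi>"
    using tame
  proof (induction rule: nonassoc.Z_tame_induct)
    case id
    then show ?case using Z_tame_id by fastforce
  next
    case (elementary E)
    then obtain j \<alpha> f where bij: "bij E" and hom: "algebra_hom E"
      and fixZ: "\<And>z. z \<in> Z \<Longrightarrow> E (nonassoc.var z) = nonassoc.var z"
      and j: "j \<in> X" "\<alpha> \<noteq> 0" "\<not> nonassoc.depends_on f j"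
      and Ej: "E (nonassoc.var j) = mon_smult \<alpha> (nonassoc.var j) + f"
      and fixX: "\<And>x. x \<in> X - {j} \<Longrightarrow> E (nonassoc.var x) = nonassoc.var x"
      by (auto simp: nonassoc.Z_elementary_def nonassoc.Z_automorphism_def
          algebra_automorphism_def)
    obtain e where e: "algebra_hom e" "e \<circ> ?\<pi> = ?\<pi> \<circ> E"
      using induced[OF hom] by blast
    obtain e' where e': "algebra_hom e'" "e' \<circ> ?\<pi> = ?\<pi> \<circ> inv_into UNIV E"
      using induced[OF algebra_hom_inv[OF hom bij]] by blast
    have e_var: "e (var v) = ?\<pi> (E (nonassoc.var v))" for v
      using fun_cong[OF e(2), of "nonassoc.var v"] by (simp add: \<pi>_var)
    have "e \<circ> e' = id"
      by (rule cancel) (use e(2) e'(2) bij in \<open>auto simp: fun_eq_iff bij_is_surj surj_f_inv_f\<close>)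
    moreover have "e' \<circ> e = id"
      by (rule cancel) (use e(2) e'(2) bij in \<open>auto simp: fun_eq_iff bij_is_inj\<close>)
    ultimately have "bij e"
      using o_bij by blast
    moreover have "\<not> depends_on (?\<pi> f) j"
    proof
      assume "depends_on (?\<pi> f) j"
      then obtain b where b: "b \<in> Poly_Mapping.keys (?\<pi> f)" "j \<in> occ b"
        by (auto simp: depends_on_def)
      have "Poly_Mapping.keys (?\<pi> f) \<subseteq> h ` Poly_Mapping.keys f"
        unfolding mon_map_def by (rule order_trans[OF Poly_Mapping.keys_sum]) (auto split: if_splits)
      with b obtain a where "a \<in> Poly_Mapping.keys f" "b = h a" by blast
      with b(2) j(3) show False
        by (auto simp: occ nonassoc.depends_on_def)
    qed
    moreover have "e (var j) = mon_smult \<alpha> (var j) + ?\<pi> f"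
      by (simp add: e_var Ej mon_map_add mon_map_smult \<pi>_var)
    ultimately have "Z_elementary X Z e"
      using e(1) j(1,2) fixX fixZ
      unfolding Z_elementary_def Z_automorphism_def algebra_automorphism_def
      by (intro conjI ballI bexI[of _ j] exI[of _ \<alpha>] exI[of _ "?\<pi> f"]) (simp_all add: e_var \<pi>_var)
    with e(2) show ?case
      using Z_tame_elementary by blast
  next
    case (inverse E)
    then obtain e where e: "Z_tame X Z e" "e \<circ> ?\<pi> = ?\<pi> \<circ> E" by blast
    have "bij e" "bij E"
      using Z_tame_bij[OF e(1)] nonassoc.Z_elementary_bij[OF inverse.hyps] by auto
    then have "inv_into UNIV e \<circ> ?\<pi> = inv_into UNIV e \<circ> (?\<pi> \<circ> E) \<circ> inv_into UNIV E"
      by (auto simp: fun_eq_iff bij_is_surj surj_f_inv_f)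
    also have "\<dots> = ?\<pi> \<circ> inv_into UNIV E"
      using \<open>bij e\<close> unfolding e(2)[symmetric] by (auto simp: fun_eq_iff bij_is_inj)
    finally show ?case
      using Z_tame_inv[OF e(1)] by blast
  next
    case (comp \<Phi> \<Psi>)
    then obtain e e' where "Z_tame X Z e" "e \<circ> ?\<pi> = ?\<pi> \<circ> \<Phi>" "Z_tame X Z e'" "e' \<circ> ?\<pi> = ?\<pi> \<circ> \<Psi>"
      by blast
    then show ?case
      by (intro exI[of _ "e \<circ> e'"] conjI Z_tame_comp) (auto simp: fun_eq_iff)
  qed
  then obtain \<phi>' where "Z_tame X Z \<phi>'" "\<phi>' \<circ> ?\<pi> = ?\<pi> \<circ> \<Phi>" by blast
  moreover from this(2) have "\<phi>' = \<phi>"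
    by (intro cancel) (use induces in \<open>auto simp: induces_via_def fun_eq_iff\<close>)
  ultimately show ?thesis by simp
qed

lemma assoc_universal:
  fixes f :: "'v \<Rightarrow> ('v, 'k::field) assoc_poly"
  shows "\<exists>e. algebra_hom e \<and> (\<forall>v. e (assoc.var v) = f v)"
proof -
  let ?m = "\<lambda>w. prod_list (map f (letters w))"
  have "algebra_hom (linear_extension ?m)"
    by (rule algebra_hom_linear_extension)
      (simp_all add: zero_word_def plus_word_def mon_mult_eq_times)
  then show ?thesis
    by (intro exI[of _ "linear_extension ?m"]) (simp add: assoc.var_def)
qed

lemma comm_universal:
  fixes f :: "'v \<Rightarrow> ('v, 'k::field) comm_poly"
  shows "\<exists>e. algebra_hom e \<and> (\<forall>v. e (comm.var v) = f v)"
proof -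
  let ?m = "\<lambda>p. \<Prod>v\<in>Poly_Mapping.keys p. f v ^ Poly_Mapping.lookup p v"
  have m: "?m p = (\<Prod>v\<in>A. f v ^ Poly_Mapping.lookup p v)"
    if "finite A" "Poly_Mapping.keys p \<subseteq> A" for p :: "'v \<Rightarrow>\<^sub>0 nat" and A
    by (rule prod.mono_neutral_left) (use that in \<open>auto simp: in_keys_iff\<close>)
  have "?m (p + q) = ?m p \<star> ?m q" for p q
  proof -
    let ?A = "Poly_Mapping.keys p \<union> Poly_Mapping.keys q"
    have "?m (p + q) = (\<Prod>v\<in>?A. f v ^ Poly_Mapping.lookup (p + q) v)"
      by (rule m[of ?A "p + q"]) (simp_all add: Poly_Mapping.keys_add)
    moreover have "?m p = (\<Prod>v\<in>?A. f v ^ Poly_Mapping.lookup p v)"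
      by (rule m[of ?A p]) simp_all
    moreover have "?m q = (\<Prod>v\<in>?A. f v ^ Poly_Mapping.lookup q v)"
      by (rule m[of ?A q]) simp_all
    ultimately show ?thesis
      by (simp only: mon_mult_eq_times lookup_add power_add prod.distrib)
  qed
  then have "algebra_hom (linear_extension ?m)"
    by (intro algebra_hom_linear_extension) simp_all
  moreover have "linear_extension ?m (comm.var v) = f v" for v
    by (simp add: comm.var_def single_var_def)
  ultimately show ?thesis by blast
qed

lemma keys_abelianize: "Poly_Mapping.keys (abelianize w) = set (letters w)"
proof -
  have "Poly_Mapping.keys (\<Sum>v\<leftarrow>xs. single_var v) = set xs" for xs :: "'a list"
    by (induction xs)
      (auto simp: in_keys_iff lookup_add single_var_def lookup_single when_def set_eq_iff split: if_splits)
  then show ?thesis by (simp add: abelianize_def)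
qed

theorem theorem4p4:
  fixes X Z :: "'v set"
  assumes "finite X" and "finite Z" and "X \<inter> Z = {}" and "X \<union> Z = UNIV"
    and "card X \<ge> 2"
  shows "(\<forall>\<phi> :: ('v, 'k::field) comm_poly \<Rightarrow> ('v, 'k) comm_poly.
            comm.Z_automorphism Z \<phi> \<longrightarrow> comm.Z_wild X Z \<phi> \<longrightarrow>
            \<not> (\<exists>\<Phi>. nonassoc.Z_automorphism Z \<Phi> \<and> induces_via nonassoc_to_comm \<Phi> \<phi>)) \<and>
         (\<forall>\<phi> :: ('v, 'k) assoc_poly \<Rightarrow> ('v, 'k) assoc_poly.
            assoc.Z_automorphism Z \<phi> \<longrightarrow> assoc.Z_wild X Z \<phi> \<longrightarrow>
            \<not> (\<exists>\<Phi>. nonassoc.Z_automorphism Z \<Phi> \<and> induces_via nonassoc_to_assoc \<Phi> \<phi>))"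
proof -
  have comm: "comm.Z_tame X Z \<phi>"
    if "nonassoc.Z_automorphism Z \<Phi>" "induces_via nonassoc_to_comm \<Phi> \<phi>"
    for \<Phi> and \<phi> :: "('v, 'k) comm_poly \<Rightarrow> ('v, 'k) comm_poly"
  proof (rule comm.tame_descends[where h = "abelianize \<circ> unbracket"])
    show "nonassoc.Z_tame X Z \<Phi>"
      by (rule nonassoc_automorphism_tame[OF assms(1,3,4) that(1)])
    have "mon_map abelianize (mon_map unbracket p) = mon_map (abelianize \<circ> unbracket) p"
      for p :: "('v, 'k) nonassoc_poly"
      by (simp add: mon_map_def[of unbracket] mon_map_sum) (simp add: mon_map_def)
    with that(2) show "induces_via (mon_map (abelianize \<circ> unbracket)) \<Phi> \<phi>"
      by (simp add: induces_via_def nonassoc_to_comm_def assoc_to_comm_def nonassoc_to_assoc_def)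
    show "surj (abelianize \<circ> unbracket :: 'v na_monomial \<Rightarrow> _)"
      by (rule comp_surj[OF surj_unbracket surj_abelianize])
    show "\<exists>e. algebra_hom e \<and> (\<forall>v. e (comm.var v) = f v)"
      for f :: "'v \<Rightarrow> ('v, 'k) comm_poly"
      by (rule comm_universal)
  qed (simp_all add: unbracket_add abelianize_add zero_na_monomial_def keys_abelianize,
      simp_all add: abelianize_def)
  have assoc: "assoc.Z_tame X Z \<phi>"
    if "nonassoc.Z_automorphism Z \<Phi>" "induces_via nonassoc_to_assoc \<Phi> \<phi>"
    for \<Phi> and \<phi> :: "('v, 'k) assoc_poly \<Rightarrow> ('v, 'k) assoc_poly"
  proof (rule assoc.tame_descends[where h = unbracket])
    show "nonassoc.Z_tame X Z \<Phi>"
      by (rule nonassoc_automorphism_tame[OF assms(1,3,4) that(1)])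
    show "induces_via (mon_map unbracket) \<Phi> \<phi>"
      using that(2) by (simp add: nonassoc_to_assoc_def)
    show "\<exists>e. algebra_hom e \<and> (\<forall>v. e (assoc.var v) = f v)"
      for f :: "'v \<Rightarrow> ('v, 'k) assoc_poly"
      by (rule assoc_universal)
  qed (simp_all add: unbracket_add zero_na_monomial_def zero_word_def surj_unbracket)
  from comm assoc show ?thesis
    by (auto simp: comm.Z_wild_def assoc.Z_wild_def)
qed

end
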